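(* Let $\eta>0$. There is no non-adaptive contention resolution algorithm, with no knowledge of the contention size $k$, that achieves latency $o\!\left(k\frac{\log k}{(\log\log k)^2}\right)$ with high probability, even against oblivious adversaries. That is, there do not exist a non-adaptive algorithm $\mathcal{A}$ (not depending on $k$) and a function $f$ with $f(k)=o\!\left(k\frac{\log k}{(\log\log k)^2}\right)$ as $k\to\infty$ such that, for every $k$ and every instance fixed in advance that activates exactly $k$ stations, with probability at least $1-1/k^{\eta}$ every station executing $\mathcal{A}$ transmits successfully within $f(k)$ rounds after its own activation.
   Context: Model. $k$ anonymous identical stations share a channel. Time is divided into discrete synchronous rounds; there is no global clock available to the stations and no collision detection. Initially all stations are asleep. Each station holds one packet. The activation round of a station is round $0$ of its local clock, and the station may transmit from its local round $1$ on. In each round every active station either transmits or listens. A transmission is successful if and only if exactly one active station transmits in that round; the transmitter then receives an acknowledgement and switches off permanently. In all other cases nothing is received. An instance is a schedule assigning to each station its activation time. An oblivious adversary knows only the algorithm's code and fixes the instance before the execution starts, without knowing the random choices of the stations. Non-adaptive algorithm without knowledge of $k$: a single probability distribution over sets of local rounds (subsets of $\{1,2,3,\ldots\}$), the same for all stations and for all values of $k$. Each station independently of the other stations draws a set from this distribution, and while it is active it transmits its packet exactly in the local rounds belonging to that set. The decisions of a station in different rounds need not be independent. *)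

theory Defs
  imports "HOL-Probability.Probability" "HOL-Library.Landau_Symbols"
begin

(* The space of sets of local rounds, with the product sigma-algebra: it is generated by
   the events "the station is to transmit in local round r". *)
definition round_sets :: "nat set measure" where
  "round_sets = sigma (Pow {1..}) ((\<lambda>r. {R. R \<subseteq> {1..} \<and> r \<in> R}) ` {1..})"

definition nonadaptive_algorithm :: "nat set measure \<Rightarrow> bool" where
  "nonadaptive_algorithm A \<longleftrightarrow> prob_space A \<and> sets A = sets round_sets"

(* The stations are the numbers i < k.  The instance a gives the global round in which station i
   is activated, so that its local clock shows t - a i in global round t \<ge> a i; S i is the set of
   local rounds drawn by station i.  The global round numbers are invisible to the stations. *)

definition attempts :: "nat set \<Rightarrow> (nat \<Rightarrow> nat) \<Rightarrow> (nat \<Rightarrow> nat set) \<Rightarrow> nat \<Rightarrow> nat set" where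
  "attempts X a S t = {i \<in> X. a i \<le> t \<and> t - a i \<in> S i}"

(* Stations that have transmitted successfully before global round t. *)
primrec switched_off :: "nat \<Rightarrow> (nat \<Rightarrow> nat) \<Rightarrow> (nat \<Rightarrow> nat set) \<Rightarrow> nat \<Rightarrow> nat set" where
  "switched_off k a S 0 = {}"
| "switched_off k a S (Suc t) =
     switched_off k a S t \<union> {i. attempts ({..<k} - switched_off k a S t) a S t = {i}}"

definition transmitters :: "nat \<Rightarrow> (nat \<Rightarrow> nat) \<Rightarrow> (nat \<Rightarrow> nat set) \<Rightarrow> nat \<Rightarrow> nat set" where
  "transmitters k a S t = attempts ({..<k} - switched_off k a S t) a S t"

definition successful :: "nat \<Rightarrow> (nat \<Rightarrow> nat) \<Rightarrow> (nat \<Rightarrow> nat set) \<Rightarrow> nat \<Rightarrow> nat \<Rightarrow> bool" where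
  "successful k a S i t \<longleftrightarrow> transmitters k a S t = {i}"

definition all_succeed_within ::
    "nat \<Rightarrow> (nat \<Rightarrow> nat) \<Rightarrow> (nat \<Rightarrow> nat set) \<Rightarrow> real \<Rightarrow> bool" where
  "all_succeed_within k a S L \<longleftrightarrow>
     (\<forall>i<k. \<exists>t. successful k a S i t \<and> real t - real (a i) \<le> L)"

definition achieves_latency_whp :: "nat set measure \<Rightarrow> real \<Rightarrow> (nat \<Rightarrow> real) \<Rightarrow> bool" where
  "achieves_latency_whp A \<eta> f \<longleftrightarrow>
     (\<forall>k\<ge>1. \<forall>a :: nat \<Rightarrow> nat.
        measure (Pi\<^sub>M {..<k} (\<lambda>_. A))
          {S \<in> space (Pi\<^sub>M {..<k} (\<lambda>_. A)). all_succeed_within k a S (f k)}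
        \<ge> 1 - 1 / real k powr \<eta>)"

(* The event measured in achieves_latency_whp is measurable, so its measure is meaningful. *)

lemma pred_round:
  assumes "nonadaptive_algorithm A"
  shows "Measurable.pred A (\<lambda>R. r \<in> R)"
proof -
  have sp: "space A = Pow {1..}"
    using assms sets_eq_imp_space_eq[of A round_sets]
    by (auto simp: nonadaptive_algorithm_def round_sets_def space_measure_of_conv)
  have "{R \<in> space A. r \<in> R} \<in> sets A"
  proof (cases "r \<ge> 1")
    case True
    have "{R. R \<subseteq> {1..} \<and> r \<in> R} \<in> sets round_sets"
      unfolding round_sets_def using True by (intro in_measure_of) auto
    then show ?thesis using assms sp by (simp add: nonadaptive_algorithm_def Pow_def)
  next
    case False
    then have "{R \<in> space A. r \<in> R} = {}" using sp by auto
    then show ?thesis by (simp only: sets.empty_sets)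
  qed
  then show ?thesis by (simp add: pred_def)
qed

lemma pred_in_round:
  assumes "nonadaptive_algorithm A" "i < k"
  shows "Measurable.pred (Pi\<^sub>M {..<k} (\<lambda>_. A)) (\<lambda>S. r \<in> S i)"
proof (rule measurable_compose[where N = A, OF _ pred_round[OF assms(1)]])
  show "(\<lambda>S. S i) \<in> Pi\<^sub>M {..<k} (\<lambda>_. A) \<rightarrow>\<^sub>M A"
    using assms(2) by (intro measurable_component_singleton) simp
qed

lemma attempts_eq_singleton:
  "attempts ({..<k} - X) a S t = {i} \<longleftrightarrow>
     i < k \<and> (\<forall>j\<in>{..<k}. (j \<notin> X \<and> a j \<le> t \<and> t - a j \<in> S j) = (j = i))"
  by (auto simp: attempts_def set_eq_iff)

lemma pred_attempts:
  assumes A: "nonadaptive_algorithm A"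
    and off: "\<And>j. Measurable.pred (Pi\<^sub>M {..<k} (\<lambda>_. A)) (\<lambda>S. j \<in> X S)"
  shows "Measurable.pred (Pi\<^sub>M {..<k} (\<lambda>_. A)) (\<lambda>S. attempts ({..<k} - X S) a S t = {i})"
  unfolding attempts_eq_singleton
  by (intro pred_intros_logic pred_intros_finite finite_lessThan off pred_in_round[OF A]
        measurable_const) auto

lemma pred_switched_off:
  assumes "nonadaptive_algorithm A"
  shows "Measurable.pred (Pi\<^sub>M {..<k} (\<lambda>_. A)) (\<lambda>S. i \<in> switched_off k a S t)"
proof (induction t arbitrary: i)
  case (Suc t)
  show ?case
    unfolding switched_off.simps Un_iff mem_Collect_eq
    by (intro pred_intros_logic Suc pred_attempts assms)
qed simp

lemma all_succeed_within_measurable: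
  assumes "nonadaptive_algorithm A"
  shows "{S \<in> space (Pi\<^sub>M {..<k} (\<lambda>_. A)). all_succeed_within k a S L}
           \<in> sets (Pi\<^sub>M {..<k} (\<lambda>_. A))"
proof -
  have "Measurable.pred (Pi\<^sub>M {..<k} (\<lambda>_. A)) (\<lambda>S. successful k a S i t)" for i t
    unfolding successful_def transmitters_def
    by (intro pred_attempts assms pred_switched_off)
  then have "Measurable.pred (Pi\<^sub>M {..<k} (\<lambda>_. A)) (\<lambda>S. all_succeed_within k a S L)"
    unfolding all_succeed_within_def by measurable
  then show ?thesis by (simp add: pred_def)
qed

end

(* The adversary mixes three kinds of stations.  A stream of about k/2 stations is activated at
   independent uniformly random times in a window of F rounds, where F dominates the claimed latency
   and has the order of k log k / (log log k)^2 with a tiny constant.  Blocks of jammers collide with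
   their first transmissions in the initial rounds, and the remaining test stations are activated together and
   must all succeed inside the window.

   When K stations start together, at most K/2 of them succeed in the first K/2 rounds.  Hence for every large
   K a station transmits with probability at least 1/4 at a local round between K/2 and K log K.  This
   gives about log k / log log k well separated scales below sqrt k, each with an expected
   1/4 "relevant" attempts, so the relevant attempts alone produce a contention that is a large
   multiple of log log k in every round of the window.

   Success feeds on success: when a station succeeds in round t, every stream station with a
   relevant attempt in t has succeeded before.  Unfolding this yields a cluster of stations, and nobody
   outside the cluster has a relevant attempt in any of its success rounds U.  As the relevant attempts
   of a station are lacunary, two translates u - Rel, u' - Rel share at most one point, so a random
   station hits a small U with probability proportional to |U|, and each cluster member costs a factor
   exp(-c log log k) that beats the polylogarithmic number of choices for it.  A cluster with
   log k / log log k members therefore never occurs and small clusters explain only a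
   polylogarithmically small fraction of the rounds, too few for the test stations.  The count of
   choices needs the expected number of attempts below sqrt k to be polylogarithmic;
   otherwise every round is blocked with high probability and there is no first success. *)

theory Submission
  imports Defs "HOL-Real_Asymp.Real_Asymp"
begin

section \<open>Combinatorics of successes: uniqueness, and forced earlier successes\<close>

section \<open>Successful transmissions\<close>

lemma switched_off_iff:
  "i \<in> switched_off k a S t \<longleftrightarrow> (\<exists>t'<t. successful k a S i t')"
proof (induction t)
  case (Suc t)
  then show ?case
    by (auto simp: successful_def transmitters_def less_Suc_eq)
qed simp

lemma successfulD:
  assumes "successful k a S i t"
  shows "i < k" "a i \<le> t" "t - a i \<in> S i" "i \<notin> switched_off k a S t"
proof -
  have "i \<in> transmitters k a S t" using assms by (simp add: successful_def)
  then show "i < k" "a i \<le> t" "t - a i \<in> S i" "i \<notin> switched_off k a S t"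
    by (auto simp: transmitters_def attempts_def)
qed

lemma successful_time_unique:
  assumes "successful k a S i t" "successful k a S i t'"
  shows "t = t'"
  using successfulD(4)[OF assms(1)] successfulD(4)[OF assms(2)] assms
  by (metis linorder_neqE_nat switched_off_iff)

lemma successful_station_unique:
  assumes "successful k a S i t" "successful k a S j t"
  shows "i = j"
  using assms by (simp add: successful_def)

text \<open>A further attempt in a round with a success can only be suppressed by being switched
  off. This step back in time drives every later descent from a success to earlier ones.\<close>

lemma successful_others_off:
  assumes "successful k a S i t" "j < k" "j \<noteq> i" "a j \<le> t" "t - a j \<in> S j"
  shows "\<exists>t'<t. successful k a S j t'"
proof (rule ccontr)
  assume "\<not> ?thesis"
  then have "j \<in> transmitters k a S t"
    using assms by (auto simp: transmitters_def attempts_def switched_off_iff)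
  then show False using assms by (simp add: successful_def)
qed

section \<open>Clusters that explain a success, and their listing as chains\<close>

section \<open>Clusters of successes\<close>

text \<open>A dependency record with root round \<open>t\<close>. A member \<open>i\<close> is
  recorded because its relevant attempt in \<open>u\<close>, the root or the success round of a
  member, had to be suppressed by its own success in \<open>v\<close>. The last clause makes the
  record complete. Since \<open>v < u\<close>, the dependence is acyclic without a further
  condition.\<close>

definition cluster ::
    "nat \<Rightarrow> nat set \<Rightarrow> (nat \<Rightarrow> nat \<Rightarrow> bool) \<Rightarrow> (nat \<Rightarrow> nat \<Rightarrow> bool) \<Rightarrow> nat \<Rightarrow> nat set \<Rightarrow> bool" where
  "cluster N T rel suc t Q \<longleftrightarrow> Q \<subseteq> {..<N} \<and>
     (\<forall>i\<in>Q. \<exists>v\<in>T. suc i v \<and> (\<exists>u. rel i u \<and> v < u \<and> (u = t \<or> (\<exists>j\<in>Q. suc j u))) \<and>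
        (\<forall>j<N. rel j v \<longrightarrow> j \<in> Q))"

text \<open>The witnesses \<open>v\<close> and \<open>u\<close> stay the same; the clauses on them
  only ask for membership in the set and so survive its enlargement.\<close>

lemma cluster_Union:
  assumes "\<And>i. i \<in> I \<Longrightarrow> cluster N T rel suc t (Q i)"
  shows "cluster N T rel suc t (\<Union>i\<in>I. Q i)"
  unfolding cluster_def
proof (intro conjI ballI)
  show "(\<Union>i\<in>I. Q i) \<subseteq> {..<N}" using assms by (auto simp: cluster_def)
next
  fix i assume "i \<in> (\<Union>i\<in>I. Q i)"
  then obtain x where x: "x \<in> I" "i \<in> Q x" by auto
  with assms[OF x(1)] obtain v where v: "v \<in> T" "suc i v"
    "\<exists>u. rel i u \<and> v < u \<and> (u = t \<or> (\<exists>j\<in>Q x. suc j u))" "\<forall>j<N. rel j v \<longrightarrow> j \<in> Q x"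
    unfolding cluster_def by blast
  show "\<exists>v\<in>T. suc i v \<and> (\<exists>u. rel i u \<and> v < u \<and> (u = t \<or> (\<exists>j\<in>(\<Union>i\<in>I. Q i). suc j u))) \<and>
        (\<forall>j<N. rel j v \<longrightarrow> j \<in> (\<Union>i\<in>I. Q i))"
    using v x(1) by (intro bexI[of _ v]) blast+
qed

text \<open>Sets are added one at a time. Just before the total reaches \<open>n\<close> it is below
  \<open>n\<close>, and the next set adds at most \<open>n\<close>.\<close>

lemma Union_card_between:
  fixes Q :: "nat \<Rightarrow> nat set"
  assumes "finite I" "\<And>i. i \<in> I \<Longrightarrow> finite (Q i) \<and> card (Q i) \<le> n" "n \<le> card (\<Union>i\<in>I. Q i)" "n > 0"
  shows "\<exists>I'\<subseteq>I. n \<le> card (\<Union>i\<in>I'. Q i) \<and> card (\<Union>i\<in>I'. Q i) < 2 * n"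
  using assms
proof (induction I rule: finite_induct)
  case (insert x I)
  show ?case
  proof (cases "n \<le> card (\<Union>i\<in>I. Q i)")
    case True
    then show ?thesis using insert by (metis insertCI subset_insertI2)
  next
    case False
    have "card (\<Union>i\<in>insert x I. Q i) \<le> card (Q x) + card (\<Union>i\<in>I. Q i)"
      by (simp add: card_Un_le)
    also have "\<dots> < n + n" using False insert.prems(1)[of x] by auto
    finally show ?thesis using insert.prems by (intro exI[of _ "insert x I"]) auto
  qed
qed auto

text \<open>Strong induction on \<open>t\<close>: each other station with a relevant attempt in
  \<open>t\<close> has succeeded earlier and brings a cluster of fewer than \<open>n\<close>
  stations; the union of these explains \<open>t\<close>. If the union is too large, a part of it
  with fewer than \<open>2 * n\<close> members is kept, so that all sizes stay in the range where
  counting works.\<close>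

lemma success_cluster:
  assumes off: "\<And>i j t. suc i t \<Longrightarrow> t \<in> T \<Longrightarrow> j < N \<Longrightarrow> j \<noteq> i \<Longrightarrow> rel j t \<Longrightarrow> \<exists>t'<t. t' \<in> T \<and> suc j t'"
    and n: "n > 0" and t: "t \<in> T" "suc i t"
  shows "(\<exists>t'\<in>T. \<exists>Q. cluster N T rel suc t' Q \<and> n \<le> card Q \<and> card Q < 2 * n) \<or>
         (\<exists>Q. cluster N T rel suc t Q \<and> card Q < n \<and> (\<forall>j<N. j \<noteq> i \<longrightarrow> rel j t \<longrightarrow> j \<in> Q))"
  using t
proof (induction t arbitrary: i rule: less_induct)
  case (less t)
  show ?case
  proof (cases "\<exists>t'\<in>T. \<exists>Q. cluster N T rel suc t' Q \<and> n \<le> card Q \<and> card Q < 2 * n")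
    case nolarge: False
    define C where "C = {j. j < N \<and> j \<noteq> i \<and> rel j t}"
    have "\<exists>t' Q. t' < t \<and> t' \<in> T \<and> suc j t' \<and> cluster N T rel suc t' Q \<and> card Q < n \<and>
            (\<forall>l<N. l \<noteq> j \<longrightarrow> rel l t' \<longrightarrow> l \<in> Q)" if jC: "j \<in> C" for j
    proof -
      obtain t' where t': "t' < t" "t' \<in> T" "suc j t'"
        using off[of i t j] less.prems jC unfolding C_def by blast
      then show ?thesis using less.IH[OF t'] nolarge by blast
    qed
    then obtain \<tau> Q where \<tau>: "\<And>j. j \<in> C \<Longrightarrow> \<tau> j < t \<and> \<tau> j \<in> T \<and> suc j (\<tau> j)"
      and Q: "\<And>j. j \<in> C \<Longrightarrow> cluster N T rel suc (\<tau> j) (Q j) \<and> card (Q j) < n \<and>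
            (\<forall>l<N. l \<noteq> j \<longrightarrow> rel l (\<tau> j) \<longrightarrow> l \<in> Q j)"
      by metis
    \<comment> \<open>Adding \<open>j\<close> turns the old root \<open>\<tau> j\<close> into the
      success round of a member, so the set can be rooted at \<open>t\<close>. It also supplies the
      one station that the induction hypothesis exempts at \<open>\<tau> j\<close>.\<close>
    define R where "R = (\<lambda>j. insert j (Q j))"
    have R: "cluster N T rel suc t (R j)" if j: "j \<in> C" for j
      unfolding cluster_def
    proof (intro conjI ballI)
      show "R j \<subseteq> {..<N}" using Q[OF j] j by (auto simp: R_def cluster_def C_def)
    next
      fix l assume l: "l \<in> R j"
      show "\<exists>v\<in>T. suc l v \<and> (\<exists>u. rel l u \<and> v < u \<and> (u = t \<or> (\<exists>j'\<in>R j. suc j' u))) \<and>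
             (\<forall>j'<N. rel j' v \<longrightarrow> j' \<in> R j)"
      proof (cases "l = j")
        case True
        then show ?thesis using \<tau>[OF j] Q[OF j] j
          by (intro bexI[of _ "\<tau> j"]) (auto simp: R_def C_def)
      next
        case False
        then have "l \<in> Q j" using l by (simp add: R_def)
        then obtain v where "v \<in> T" "suc l v"
          "\<exists>u. rel l u \<and> v < u \<and> (u = \<tau> j \<or> (\<exists>j'\<in>Q j. suc j' u))" "\<forall>j'<N. rel j' v \<longrightarrow> j' \<in> Q j"
          using Q[OF j] unfolding cluster_def by blast
        then show ?thesis using \<tau>[OF j] by (intro bexI[of _ v]) (auto simp: R_def)
      qed
    qed
    have finC: "finite C" by (simp add: C_def)
    have cardR: "finite (R j) \<and> card (R j) \<le> n" if j: "j \<in> C" for j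
    proof -
      have "finite (Q j)" using Q[OF j] finite_subset[of "Q j" "{..<N}"] by (auto simp: cluster_def)
      then show ?thesis using Q[OF j] by (auto simp: R_def card_insert_if)
    qed
    have "card (\<Union>j\<in>C. R j) < n"
    proof (rule ccontr)
      assume "\<not> ?thesis"
      then obtain I' where I': "I' \<subseteq> C" "n \<le> card (\<Union>j\<in>I'. R j)" "card (\<Union>j\<in>I'. R j) < 2 * n"
        using Union_card_between[OF finC cardR] n by (meson not_less)
      have "cluster N T rel suc t (\<Union>j\<in>I'. R j)" using I'(1) R by (intro cluster_Union) auto
      then show False using nolarge less.prems(1) I' by blast
    qed
    moreover have "cluster N T rel suc t (\<Union>j\<in>C. R j)" using R by (intro cluster_Union) auto
    moreover have "\<forall>j<N. j \<noteq> i \<longrightarrow> rel j t \<longrightarrow> j \<in> (\<Union>j\<in>C. R j)" by (auto simp: C_def R_def)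
    ultimately show ?thesis by blast
  qed simp
qed

text \<open>A cluster is listed by increasing success time, so that each entry finds its parent further
  down the list.\<close>

primrec chain :: "(nat \<Rightarrow> nat \<Rightarrow> nat \<Rightarrow> bool) \<Rightarrow> nat \<Rightarrow> (nat \<times> nat) list \<Rightarrow> bool" where
  "chain link t [] \<longleftrightarrow> True"
| "chain link t (x # zs) \<longleftrightarrow>
     (\<exists>u\<in>insert t (snd ` set zs). link (fst x) u (snd x)) \<and> chain link t zs"

text \<open>Induction on the size, removing the member \<open>i\<close> with the earliest success.
  Parent rounds lie strictly after the successes they explain, so none of them is the success round
  of \<open>i\<close>: the rest keeps all its parents, and \<open>i\<close> can be put in
  front.\<close>

lemma cluster_chain_aux:
  assumes uniq: "\<And>i t t'. suc i t \<Longrightarrow> suc i t' \<Longrightarrow> t = t'"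
    and uniq': "\<And>i j t. suc i t \<Longrightarrow> suc j t \<Longrightarrow> i = j"
    and link: "\<And>i u v. rel i u \<Longrightarrow> v < u \<Longrightarrow> suc i v \<Longrightarrow> link i u v"
    and "finite Q"
    and "\<forall>i\<in>Q. \<exists>v\<in>T. suc i v \<and> (\<exists>u. rel i u \<and> v < u \<and> (u = t \<or> (\<exists>j\<in>Q. suc j u)))"
  shows "\<exists>xs. chain link t xs \<and> fst ` set xs = Q \<and> distinct (map fst xs) \<and> distinct (map snd xs) \<and>
           (\<forall>x\<in>set xs. snd x \<in> T \<and> suc (fst x) (snd x))"
  using assms(4,5)
proof (induction "card Q" arbitrary: Q)
  case 0
  then have "Q = {}" by simp
  then show ?case by (intro exI[of _ "[]"]) simp
next
  case (Suc n Q)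
  define \<tau> where "\<tau> = (\<lambda>i. THE v. suc i v)"
  have \<tau>eq: "\<tau> i = v" if "suc i v" for i v
    unfolding \<tau>_def using that uniq by (intro the_equality) auto
  have Qne: "Q \<noteq> {}" using Suc.hyps(2) by auto
  define i where "i = arg_min_on \<tau> Q"
  have i: "i \<in> Q" "\<And>j. j \<in> Q \<Longrightarrow> \<tau> i \<le> \<tau> j"
    unfolding i_def using Qne \<open>finite Q\<close> by (auto intro: arg_min_if_finite(1) arg_min_least)
  obtain v u where v: "v \<in> T" "suc i v" "rel i u" "v < u" "u = t \<or> (\<exists>j\<in>Q. suc j u)"
    using Suc.prems(2) i(1) by blast
  have par: "\<exists>v\<in>T. suc j v \<and> (\<exists>u. rel j u \<and> v < u \<and> (u = t \<or> (\<exists>l\<in>Q - {i}. suc l u)))" if j: "j \<in> Q - {i}" for j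
  proof -
    obtain v' u' where v': "v' \<in> T" "suc j v'" "rel j u'" "v' < u'" "u' = t \<or> (\<exists>l\<in>Q. suc l u')"
      using Suc.prems(2) j by blast
    have "v \<le> v'" using i(2)[of j] j \<tau>eq[OF v(2)] \<tau>eq[OF v'(2)] by auto
    then have "\<not> suc i u'" using uniq[OF v(2)] v'(4) by fastforce
    then show ?thesis using v' by (intro bexI[of _ v']) auto
  qed
  have "n = card (Q - {i})" using Suc.hyps(2) i(1) \<open>finite Q\<close> by simp
  from Suc.hyps(1)[OF this] obtain zs where zs: "chain link t zs" "fst ` set zs = Q - {i}"
      "distinct (map fst zs)" "distinct (map snd zs)" "\<forall>x\<in>set zs. snd x \<in> T \<and> suc (fst x) (snd x)"
    using par \<open>finite Q\<close> by auto
  have "u \<in> insert t (snd ` set zs)"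
  proof (cases "u = t")
    case False
    then obtain j where j: "j \<in> Q" "suc j u" using v(5) by auto
    have "j \<noteq> i" using uniq[OF v(2)] j(2) v(4) by fastforce
    then have "j \<in> fst ` set zs" using zs(2) j(1) by simp
    then obtain x where "x \<in> set zs" "fst x = j" by auto
    then show ?thesis using zs(5) uniq[OF j(2)] by (metis image_eqI insertCI)
  qed simp
  moreover have "v \<notin> snd ` set zs"
  proof
    assume "v \<in> snd ` set zs"
    then obtain x where x: "x \<in> set zs" "snd x = v" by auto
    then have "fst x = i" using zs(5) uniq' v(2) by blast
    then show False using x zs(2) by blast
  qed
  moreover have "i \<notin> fst ` set zs" using zs(2) by blast
  ultimately show ?case using zs v i(1) link[OF v(3,4,2)]
    by (intro exI[of _ "(i,v) # zs"]) auto
qed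

text \<open>Success rounds are unique, so the round that \<open>cluster\<close> attaches to a member
  is the listed one. This carries the last clause of \<open>cluster\<close> over to the
  list.\<close>

lemma cluster_chain:
  assumes uniq: "\<And>i t t'. suc i t \<Longrightarrow> suc i t' \<Longrightarrow> t = t'"
    and uniq': "\<And>i j t. suc i t \<Longrightarrow> suc j t \<Longrightarrow> i = j"
    and link: "\<And>i u v. rel i u \<Longrightarrow> v < u \<Longrightarrow> suc i v \<Longrightarrow> link i u v"
    and cl: "cluster N T rel suc t Q"
  shows "\<exists>xs. chain link t xs \<and> length xs = card Q \<and> distinct (map fst xs) \<and> distinct (map snd xs) \<and>
           set xs \<subseteq> {..<N} \<times> T \<and> (\<forall>j<N. j \<notin> fst ` set xs \<longrightarrow> (\<forall>v\<in>snd ` set xs. \<not> rel j v))"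
proof -
  have fin: "finite Q" using cl finite_subset[of Q "{..<N}"] by (auto simp: cluster_def)
  have parent: "\<forall>i\<in>Q. \<exists>v\<in>T. suc i v \<and> (\<exists>u. rel i u \<and> v < u \<and> (u = t \<or> (\<exists>j\<in>Q. suc j u)))"
    using cl unfolding cluster_def by blast
  have "\<exists>xs. chain link t xs \<and> fst ` set xs = Q \<and> distinct (map fst xs) \<and> distinct (map snd xs) \<and>
           (\<forall>x\<in>set xs. snd x \<in> T \<and> suc (fst x) (snd x))"
    by (rule cluster_chain_aux[of suc rel link]) (fact uniq uniq' link fin parent)+
  then obtain xs
    where xs: "chain link t xs" "fst ` set xs = Q" "distinct (map fst xs)" "distinct (map snd xs)"
      "\<forall>x\<in>set xs. snd x \<in> T \<and> suc (fst x) (snd x)" by blast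
  have "length xs = card Q" using xs(2,3) by (metis distinct_card length_map list.set_map)
  moreover have "set xs \<subseteq> {..<N} \<times> T"
  proof
    fix x assume x: "x \<in> set xs"
    then have "fst x \<in> {..<N}" "snd x \<in> T"
      using xs(2,5) cl unfolding cluster_def by auto
    then show "x \<in> {..<N} \<times> T" by (cases x) auto
  qed
  moreover have "\<not> rel j v" if j: "j < N" "j \<notin> fst ` set xs" "v \<in> snd ` set xs" for j v
  proof -
    obtain x where x: "x \<in> set xs" "snd x = v" using j(3) by auto
    then have "fst x \<in> Q" "suc (fst x) v" using xs(2,5) by auto
    then obtain v' where v': "suc (fst x) v'" "\<forall>j<N. rel j v' \<longrightarrow> j \<in> Q"
      using cl unfolding cluster_def by blast
    then have "v' = v" using uniq \<open>suc (fst x) v\<close> by blast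
    then show ?thesis using v' j xs(2) by blast
  qed
  ultimately show ?thesis using xs by blast
qed

section \<open>Averages over independent draws and activation times\<close>

section \<open>Random activation times\<close>

lemma (in finite_measure) integrable_real_indicator_finite:
  "B \<in> sets M \<Longrightarrow> integrable M (indicator B :: _ \<Rightarrow> real)"
  by (rule integrable_real_indicator) (simp_all add: less_top[symmetric])

text \<open>Integrate the number of events that occur: it is at most \<open>m\<close> on
  \<open>H\<close> and zero elsewhere.\<close>

lemma (in finite_measure) sum_measure_le_multiplicity:
  assumes "finite X" "\<And>x. x \<in> X \<Longrightarrow> G x \<in> sets M" "H \<in> sets M"
    and "\<And>x. x \<in> X \<Longrightarrow> G x \<subseteq> H"
    and "\<And>\<omega>. \<omega> \<in> H \<Longrightarrow> card {x\<in>X. \<omega> \<in> G x} \<le> m"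
  shows "(\<Sum>x\<in>X. measure M (G x)) \<le> real m * measure M H"
proof -
  have "(\<Sum>x\<in>X. measure M (G x)) = (\<Sum>x\<in>X. \<integral>\<omega>. indicator (G x) \<omega> \<partial>M)"
    using assms(2) by (intro sum.cong) auto
  also have "\<dots> = (\<integral>\<omega>. (\<Sum>x\<in>X. indicator (G x) \<omega>) \<partial>M)"
    using assms(2) by (intro Bochner_Integration.integral_sum[symmetric] integrable_real_indicator_finite)
  also have "\<dots> \<le> (\<integral>\<omega>. real m * indicator H \<omega> \<partial>M)"
  proof (rule integral_mono)
    fix \<omega> assume "\<omega> \<in> space M"
    have eq: "(\<Sum>x\<in>X. indicator (G x) \<omega> :: real) = real (card {x\<in>X. \<omega> \<in> G x})"
    proof -
      have "(\<Sum>x\<in>X. indicator (G x) \<omega> :: real) = (\<Sum>x\<in>X. if \<omega> \<in> G x then 1 else 0)"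
        by (intro sum.cong) auto
      also have "\<dots> = real (card {x\<in>X. \<omega> \<in> G x})"
        using assms(1) by (simp add: sum.If_cases Int_def)
      finally show ?thesis .
    qed
    show "(\<Sum>x\<in>X. indicator (G x) \<omega>) \<le> real m * indicator H \<omega>"
    proof (cases "\<omega> \<in> H")
      case True
      then show ?thesis unfolding eq using assms(5) by simp
    next
      case False
      then have "{x\<in>X. \<omega> \<in> G x} = {}" using assms(4) by auto
      then show ?thesis unfolding eq using False by (simp only: card.empty) simp
    qed
  qed (use assms(2,3) in \<open>auto intro!: integrable_real_indicator_finite\<close>)
  also have "\<dots> = real m * measure M H" using assms(3) by simp
  finally show ?thesis .
qed

text \<open>Markov's inequality for the number of events that occur.\<close>

lemma (in finite_measure) measure_card_ge_le:
  assumes "finite X" "\<And>x. x \<in> X \<Longrightarrow> G x \<in> sets M" "E \<in> sets M" "c > 0"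
    and "\<And>\<omega>. \<omega> \<in> E \<Longrightarrow> c \<le> card {x\<in>X. \<omega> \<in> G x}"
  shows "measure M E \<le> (\<Sum>x\<in>X. measure M (G x)) / real c"
proof -
  have "real c * measure M E = (\<integral>\<omega>. real c * indicator E \<omega> \<partial>M)" using assms(3) by simp
  also have "\<dots> \<le> (\<integral>\<omega>. (\<Sum>x\<in>X. indicator (G x) \<omega>) \<partial>M)"
  proof (rule integral_mono)
    fix \<omega> assume "\<omega> \<in> space M"
    have "(\<Sum>x\<in>X. indicator (G x) \<omega> :: real) = (\<Sum>x\<in>X. if \<omega> \<in> G x then 1 else 0)"
      by (intro sum.cong) auto
    also have "\<dots> = real (card {x\<in>X. \<omega> \<in> G x})"
      using assms(1) by (simp add: sum.If_cases Int_def)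
    finally show "real c * indicator E \<omega> \<le> (\<Sum>x\<in>X. indicator (G x) \<omega>)"
      using assms(5)[of \<omega>] by (cases "\<omega> \<in> E") auto
  qed (use assms(2,3) in \<open>auto intro!: integrable_real_indicator_finite\<close>)
  also have "\<dots> = (\<Sum>x\<in>X. \<integral>\<omega>. indicator (G x) \<omega> \<partial>M)"
    using assms(2) by (intro Bochner_Integration.integral_sum integrable_real_indicator_finite)
  also have "\<dots> = (\<Sum>x\<in>X. measure M (G x))"
    using assms(2) by (intro sum.cong) auto
  finally show ?thesis using assms(4) by (simp add: field_simps)
qed

text \<open>Induction with inclusion-exclusion for two sets. The correction runs over ordered pairs
  and so counts each pair twice, which only weakens the bound.\<close>

lemma (in finite_measure) measure_UN_ge_Bonferroni:
  assumes "finite U" "\<And>u. u \<in> U \<Longrightarrow> G u \<in> sets M"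
  shows "(\<Sum>u\<in>U. measure M (G u)) - (\<Sum>u\<in>U. \<Sum>u'\<in>U - {u}. measure M (G u \<inter> G u'))
           \<le> measure M (\<Union>u\<in>U. G u)"
  using assms
proof (induction U rule: finite_induct)
  case (insert x U)
  have G: "G u \<in> sets M" if "u \<in> insert x U" for u using insert.prems that by blast
  have UN: "(\<Union>u\<in>U. G u) \<in> sets M" using G insert.hyps by auto
  have "measure M (G x \<inter> (\<Union>u\<in>U. G u)) \<le> (\<Sum>u\<in>U. measure M (G x \<inter> G u))"
  proof -
    have "G x \<inter> (\<Union>u\<in>U. G u) = (\<Union>u\<in>U. G x \<inter> G u)" by auto
    moreover have "measure M (\<Union>u\<in>U. G x \<inter> G u) \<le> (\<Sum>u\<in>U. measure M (G x \<inter> G u))"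
      using insert.hyps G by (intro finite_measure_subadditive_finite) auto
    ultimately show ?thesis by simp
  qed
  moreover have "measure M (G x \<union> (\<Union>u\<in>U. G u)) =
      measure M (G x) + measure M (\<Union>u\<in>U. G u) - measure M (G x \<inter> (\<Union>u\<in>U. G u))"
    using measure_Un3[of "G x" M "\<Union>u\<in>U. G u"] G UN by (simp add: fmeasurable_eq_sets)
  moreover have "(\<Sum>u\<in>insert x U. \<Sum>u'\<in>insert x U - {u}. measure M (G u \<inter> G u'))
      \<ge> (\<Sum>u\<in>U. measure M (G x \<inter> G u)) + (\<Sum>u\<in>U. \<Sum>u'\<in>U - {u}. measure M (G u \<inter> G u'))"
  proof -
    have "(\<Sum>u\<in>U. \<Sum>u'\<in>U - {u}. measure M (G u \<inter> G u')) \<le>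
            (\<Sum>u\<in>U. \<Sum>u'\<in>insert x U - {u}. measure M (G u \<inter> G u'))"
      using insert.hyps by (intro sum_mono sum_mono2) auto
    moreover have "insert x U - {x} = U" using insert.hyps by auto
    ultimately show ?thesis using insert.hyps by simp
  qed
  moreover note insert.IH[OF G]
  ultimately show ?case using insert.hyps by simp
qed simp

locale nonadaptive =
  fixes A :: "nat set measure"
  assumes nonadaptive: "nonadaptive_algorithm A"
begin

sublocale prob_space A using nonadaptive by (simp add: nonadaptive_algorithm_def)

lemma space_A: "space A = Pow {1..}"
  using nonadaptive sets_eq_imp_space_eq[of A round_sets]
  by (auto simp: nonadaptive_algorithm_def round_sets_def space_measure_of_conv)

lemma pred_mem [measurable]: "Measurable.pred A (\<lambda>S. r \<in> S)"
  using pred_round[OF nonadaptive] .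

text \<open>The event is a box in the product space whose sides outside \<open>I\<close> have
  measure one.\<close>

lemma measure_coords:
  fixes k :: nat
  assumes "I \<subseteq> {..<k}" "\<And>i. i \<in> I \<Longrightarrow> Measurable.pred A (\<phi> i)"
  shows "measure (Pi\<^sub>M {..<k} (\<lambda>_. A)) {S \<in> space (Pi\<^sub>M {..<k} (\<lambda>_. A)). \<forall>i\<in>I. \<phi> i (S i)}
           = (\<Prod>i\<in>I. measure A {S \<in> space A. \<phi> i S})"
proof -
  interpret P: finite_product_prob_space "\<lambda>_. A" "{..<k}"
    by unfold_locales auto
  define X where "X = (\<lambda>i. {S \<in> space A. i \<in> I \<longrightarrow> \<phi> i S})"
  have X: "X i \<in> sets A" for i
    using assms(2)[of i] by (cases "i \<in> I") (auto simp: X_def)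
  have "{S \<in> space (Pi\<^sub>M {..<k} (\<lambda>_. A)). \<forall>i\<in>I. \<phi> i (S i)} = Pi\<^sub>E {..<k} X"
  proof (intro set_eqI iffI)
    fix S assume "S \<in> {S \<in> space (Pi\<^sub>M {..<k} (\<lambda>_. A)). \<forall>i\<in>I. \<phi> i (S i)}"
    then show "S \<in> Pi\<^sub>E {..<k} X" by (simp add: X_def space_PiM PiE_iff)
  next
    fix S assume "S \<in> Pi\<^sub>E {..<k} X"
    then show "S \<in> {S \<in> space (Pi\<^sub>M {..<k} (\<lambda>_. A)). \<forall>i\<in>I. \<phi> i (S i)}"
      using assms(1) by (simp add: X_def space_PiM PiE_iff subset_eq)
  qed
  then have "measure (Pi\<^sub>M {..<k} (\<lambda>_. A)) {S \<in> space (Pi\<^sub>M {..<k} (\<lambda>_. A)). \<forall>i\<in>I. \<phi> i (S i)}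
      = (\<Prod>i<k. measure A (X i))"
    using P.prob_times[of X] X by simp
  also have "\<dots> = (\<Prod>i\<in>I. measure A (X i))"
    using assms(1) by (intro prod.mono_neutral_right) (auto simp: X_def prob_space)
  also have "\<dots> = (\<Prod>i\<in>I. measure A {S \<in> space A. \<phi> i S})"
    by (intro prod.cong) (auto simp: X_def)
  finally show ?thesis .
qed

lemma pred_coord:
  fixes k :: nat
  assumes "I \<subseteq> {..<k}" "\<And>i. i \<in> I \<Longrightarrow> Measurable.pred A (\<phi> i)"
  shows "{S \<in> space (Pi\<^sub>M {..<k} (\<lambda>_. A)). \<forall>i\<in>I. \<phi> i (S i)} \<in> sets (Pi\<^sub>M {..<k} (\<lambda>_. A))"
proof -
  have "Measurable.pred (Pi\<^sub>M {..<k} (\<lambda>_. A)) (\<lambda>S. \<phi> i (S i))" if "i \<in> I" for i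
    using measurable_compose[where N = A, OF measurable_component_singleton[of i "{..<k}" "\<lambda>_. A"] assms(2)[OF that]]
      that assms(1) by auto
  then have "Measurable.pred (Pi\<^sub>M {..<k} (\<lambda>_. A)) (\<lambda>S. \<forall>i\<in>I. \<phi> i (S i))"
    using finite_subset[OF assms(1)] by (intro pred_intros_finite) auto
  then show ?thesis by (simp add: pred_def)
qed

end

text \<open>\<open>N\<close> stream stations are activated at random in a window of \<open>F\<close>
  rounds starting with \<open>d\<close>, and \<open>Rel\<close> selects the attempts that are taken
  into account. It is kept abstract because it is used twice: with all attempts up to
  \<open>T\<close> when attempts are dense, and with one attempt per scale when they are
  sparse.\<close>

locale stream = nonadaptive +
  fixes Rel :: "nat set \<Rightarrow> nat set" and d F T N :: nat
  assumes F_pos: "F > 0"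
    and Rel_subset: "Rel S \<subseteq> S \<inter> {1..T}"
    and Rel_meas [measurable]: "Measurable.pred A (\<lambda>S. r \<in> Rel S)"
begin

definition window :: "nat set" where "window = {d..<d + F}"

text \<open>For a round \<open>u\<close> in this range all activation times \<open>u - r\<close>
  with \<open>1 \<le> r \<le> T\<close> lie in \<open>window\<close>, so there are no boundary
  effects. The rounds between \<open>d\<close> and this range are left to the jammers.\<close>

definition main :: "nat set" where "main = {d + T<..d + F}"

definition schedules :: "(nat \<Rightarrow> nat) set" where "schedules = Pi\<^sub>E {..<N} (\<lambda>_. window)"

text \<open>The randomness of the adversary is a finite average over fixed schedules, so every term
  of it is an admissible oblivious instance.\<close>

definition avg :: "((nat \<Rightarrow> nat) \<Rightarrow> real) \<Rightarrow> real" where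
  "avg g = (\<Sum>\<alpha>\<in>schedules. g \<alpha>) / real F ^ N"

text \<open>Probability of an event about one station when its activation time and its set of rounds
  are both random.\<close>

definition pav :: "(nat \<Rightarrow> nat set \<Rightarrow> bool) \<Rightarrow> real" where
  "pav \<phi> = (\<Sum>x\<in>window. measure A {S \<in> space A. \<phi> x S}) / real F"

definition hits :: "nat \<Rightarrow> nat \<Rightarrow> nat set \<Rightarrow> bool" where
  "hits u x S \<longleftrightarrow> x \<le> u \<and> u - x \<in> Rel S"

lemma hits_meas [measurable]: "Measurable.pred A (\<lambda>S. hits u x S)"
  unfolding hits_def by measurable

lemma finite_window [simp]: "finite window" and card_window [simp]: "card window = F"
  by (simp_all add: window_def)

lemma finite_main [simp]: "finite main"
  by (simp add: main_def)

lemma finite_schedules [simp]: "finite schedules"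
  by (simp add: schedules_def finite_PiE)

lemma card_schedules: "card schedules = F ^ N"
  by (simp add: schedules_def card_PiE)

lemma avg_const: "avg (\<lambda>_. c) = c"
  using F_pos by (simp add: avg_def card_schedules)

lemma avg_mono: "(\<And>\<alpha>. \<alpha> \<in> schedules \<Longrightarrow> g \<alpha> \<le> h \<alpha>) \<Longrightarrow> avg g \<le> avg h"
  unfolding avg_def by (intro divide_right_mono sum_mono) auto

lemma avg_add: "avg (\<lambda>\<alpha>. g \<alpha> + h \<alpha>) = avg g + avg h"
  by (simp add: avg_def sum.distrib add_divide_distrib)

lemma avg_sum: "avg (\<lambda>\<alpha>. \<Sum>x\<in>X. g x \<alpha>) = (\<Sum>x\<in>X. avg (g x))"
  unfolding avg_def by (subst sum.swap) (simp add: sum_divide_distrib)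

lemma avg_divide: "avg (\<lambda>\<alpha>. g \<alpha> / c) = avg g / c"
  by (simp add: avg_def sum_divide_distrib mult.commute)

text \<open>Independence in both sources of randomness: for fixed times the draws factor, and the
  sum over \<open>schedules\<close> of a product is a product of sums. The map \<open>a\<close> has
  to agree with \<open>\<alpha>\<close> only on \<open>I\<close>, because jammers and tests follow
  fixed times.\<close>

lemma avg_coords:
  assumes "N \<le> k" "I \<subseteq> {..<N}" "\<And>i x. i \<in> I \<Longrightarrow> Measurable.pred A (\<phi> i x)"
    and "\<And>\<alpha> i. \<alpha> \<in> schedules \<Longrightarrow> i \<in> I \<Longrightarrow> a \<alpha> i = \<alpha> i"
  shows "avg (\<lambda>\<alpha>. measure (Pi\<^sub>M {..<k} (\<lambda>_. A))
             {S \<in> space (Pi\<^sub>M {..<k} (\<lambda>_. A)). \<forall>i\<in>I. \<phi> i (a \<alpha> i) (S i)})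
           = (\<Prod>i\<in>I. pav (\<phi> i))"
proof -
  define p where "p = (\<lambda>i x. if i \<in> I then measure A {S \<in> space A. \<phi> i x S} else 1)"
  have "avg (\<lambda>\<alpha>. measure (Pi\<^sub>M {..<k} (\<lambda>_. A))
             {S \<in> space (Pi\<^sub>M {..<k} (\<lambda>_. A)). \<forall>i\<in>I. \<phi> i (a \<alpha> i) (S i)}) =
        avg (\<lambda>\<alpha>. \<Prod>i<N. p i (\<alpha> i))"
    unfolding avg_def
  proof (intro arg_cong2[where f = "(/)"] sum.cong refl)
    fix \<alpha> assume \<alpha>: "\<alpha> \<in> schedules"
    have "measure (Pi\<^sub>M {..<k} (\<lambda>_. A))
             {S \<in> space (Pi\<^sub>M {..<k} (\<lambda>_. A)). \<forall>i\<in>I. \<phi> i (a \<alpha> i) (S i)} =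
          (\<Prod>i\<in>I. measure A {S \<in> space A. \<phi> i (a \<alpha> i) S})"
      using assms by (intro measure_coords) auto
    also have "\<dots> = (\<Prod>i\<in>I. p i (\<alpha> i))"
      using assms(4)[OF \<alpha>] by (intro prod.cong) (auto simp: p_def)
    also have "\<dots> = (\<Prod>i<N. p i (\<alpha> i))"
      using assms(2) by (intro prod.mono_neutral_left) (auto simp: p_def)
    finally show "measure (Pi\<^sub>M {..<k} (\<lambda>_. A))
             {S \<in> space (Pi\<^sub>M {..<k} (\<lambda>_. A)). \<forall>i\<in>I. \<phi> i (a \<alpha> i) (S i)} = (\<Prod>i<N. p i (\<alpha> i))" .
  qed
  also have "\<dots> = (\<Prod>i<N. \<Sum>x\<in>window. p i x) / real F ^ N"
    unfolding avg_def schedules_def by (subst prod_sum_PiE) auto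
  also have "\<dots> = (\<Prod>i<N. (\<Sum>x\<in>window. p i x) / real F)"
    by (simp add: prod_dividef)
  also have "\<dots> = (\<Prod>i\<in>I. (\<Sum>x\<in>window. p i x) / real F)"
    using assms(2) F_pos by (intro prod.mono_neutral_right) (auto simp: p_def)
  also have "\<dots> = (\<Prod>i\<in>I. pav (\<phi> i))"
    by (intro prod.cong) (auto simp: p_def pav_def)
  finally show ?thesis .
qed

lemma pav_nonneg: "0 \<le> pav \<phi>"
  unfolding pav_def by (intro divide_nonneg_nonneg sum_nonneg) auto

lemma pav_le_1: "pav \<phi> \<le> 1"
proof -
  have "(\<Sum>x\<in>window. measure A {S \<in> space A. \<phi> x S}) \<le> (\<Sum>x\<in>window. 1)"
    by (intro sum_mono) auto
  then show ?thesis using F_pos by (simp add: pav_def)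
qed

lemma pav_not:
  assumes [measurable]: "\<And>x. Measurable.pred A (\<phi> x)"
  shows "pav (\<lambda>x S. \<not> \<phi> x S) = 1 - pav \<phi>"
proof -
  have "measure A {S \<in> space A. \<not> \<phi> x S} = 1 - measure A {S \<in> space A. \<phi> x S}" for x
    by (rule prob_neg) measurable
  then show ?thesis using F_pos by (simp add: pav_def sum_subtractf diff_divide_distrib)
qed

lemma pav_Bex_le:
  assumes "finite U" and [measurable]: "\<And>u x. Measurable.pred A (\<phi> u x)"
  shows "pav (\<lambda>x S. \<exists>u\<in>U. \<phi> u x S) \<le> (\<Sum>u\<in>U. pav (\<phi> u))"
proof -
  have "measure A {S \<in> space A. \<exists>u\<in>U. \<phi> u x S} \<le> (\<Sum>u\<in>U. measure A {S \<in> space A. \<phi> u x S})" for x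
  proof -
    have "{S \<in> space A. \<exists>u\<in>U. \<phi> u x S} = (\<Union>u\<in>U. {S \<in> space A. \<phi> u x S})" by auto
    moreover have "measure A (\<Union>u\<in>U. {S \<in> space A. \<phi> u x S}) \<le> (\<Sum>u\<in>U. measure A {S \<in> space A. \<phi> u x S})"
      using assms(1) by (intro finite_measure_subadditive_finite) auto
    ultimately show ?thesis by simp
  qed
  then have "(\<Sum>x\<in>window. measure A {S \<in> space A. \<exists>u\<in>U. \<phi> u x S}) \<le>
      (\<Sum>x\<in>window. \<Sum>u\<in>U. measure A {S \<in> space A. \<phi> u x S})" by (intro sum_mono)
  also have "\<dots> = (\<Sum>u\<in>U. \<Sum>x\<in>window. measure A {S \<in> space A. \<phi> u x S})" by (rule sum.swap)
  finally show ?thesis unfolding pav_def sum_divide_distrib[symmetric]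
    by (intro divide_right_mono) auto
qed

text \<open>Substituting \<open>x = u - r\<close> turns the sum over activation times into a sum
  over local rounds, so the value is the same for all rounds of \<open>main\<close>.\<close>

lemma pav_hits:
  assumes "u \<in> main"
  shows "pav (hits u) = (\<Sum>r=1..T. measure A {S \<in> space A. r \<in> Rel S}) / real F"
proof -
  have "(\<Sum>x\<in>window. measure A {S \<in> space A. hits u x S})
      = (\<Sum>x\<in>(\<lambda>r. u - r) ` {1..T}. measure A {S \<in> space A. hits u x S})"
  proof (rule sum.mono_neutral_right)
    show "(\<lambda>r. u - r) ` {1..T} \<subseteq> window" using assms by (auto simp: window_def main_def)
    show "\<forall>x\<in>window - (\<lambda>r. u - r) ` {1..T}. measure A {S \<in> space A. hits u x S} = 0"
    proof
      fix x assume x: "x \<in> window - (\<lambda>r. u - r) ` {1..T}"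
      have "\<not> hits u x S" for S
      proof
        assume h: "hits u x S"
        then have "u - x \<in> {1..T}" "x = u - (u - x)" using Rel_subset[of S] by (auto simp: hits_def)
        then show False using x by blast
      qed
      then show "measure A {S \<in> space A. hits u x S} = 0" by simp
    qed
  qed simp
  also have "\<dots> = (\<Sum>r=1..T. measure A {S \<in> space A. hits u (u - r) S})"
    using assms by (subst sum.reindex) (auto simp: inj_on_def main_def)
  also have "\<dots> = (\<Sum>r=1..T. measure A {S \<in> space A. r \<in> Rel S})"
    using assms by (intro sum.cong) (auto simp: hits_def main_def)
  finally show ?thesis by (simp add: pav_def)
qed

end

section \<open>Union bounds over the possible listings of a cluster\<close>

section \<open>Counting clusters\<close>

lemma sum_le_sum_superset_vanish:
  fixes g :: "'a \<Rightarrow> real"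
  assumes "finite X" "finite Y" "\<And>x. 0 \<le> g x" "\<And>x. x \<in> X \<Longrightarrow> x \<notin> Y \<Longrightarrow> g x = 0"
  shows "sum g X \<le> sum g Y"
proof -
  have "sum g X = sum g (X \<inter> Y)" using assms by (intro sum.mono_neutral_right) auto
  also have "\<dots> \<le> sum g Y" using assms by (intro sum_mono2) auto
  finally show ?thesis .
qed

text \<open>The Sidon condition: in each drawn set a positive difference of relevant attempts occurs
  at most once. Later \<open>m\<close> is the number of scales, and 1/4 bounds from below the
  probability of an attempt on a single scale.\<close>

locale sidon_stream = stream +
  fixes m :: nat
  assumes card_Rel: "card (Rel S) \<le> m"
    and Rel_sidon: "r \<in> Rel S \<Longrightarrow> r + e \<in> Rel S \<Longrightarrow> q \<in> Rel S \<Longrightarrow> q + e \<in> Rel S \<Longrightarrow> e > 0 \<Longrightarrow> r = q"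
    and Rel_mass: "real m / 4 \<le> (\<Sum>r=1..T. measure A {S \<in> space A. r \<in> Rel S})"
begin

definition load :: real where "load = (\<Sum>r=1..T. measure A {S \<in> space A. r \<in> S})"

text \<open>The success round \<open>v\<close> may come from any attempt, not only from a relevant
  one. Hence \<open>load\<close> counts all attempts up to \<open>T\<close>.\<close>

definition link :: "nat \<Rightarrow> nat \<Rightarrow> nat \<Rightarrow> nat set \<Rightarrow> bool" where
  "link u v x S \<longleftrightarrow> hits u x S \<and> v < u \<and> x \<le> v \<and> v - x \<in> S"

lemma link_meas [measurable]: "Measurable.pred A (\<lambda>S. link u v x S)"
  unfolding link_def by measurable

lemma load_nonneg: "0 \<le> load"
  unfolding load_def by (intro sum_nonneg) auto

text \<open>The two pairs of relevant attempts would have the same difference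
  \<open>u' - u\<close>.\<close>

lemma hits_sidon:
  assumes "hits u x S" "hits u' x S" "hits u y S" "hits u' y S" "u < u'"
  shows "x = y"
proof -
  have "u - x = u - y"
  proof (rule Rel_sidon[of _ S "u' - u"])
    show "u - x \<in> Rel S" "u - y \<in> Rel S" "u' - u > 0" using assms by (auto simp: hits_def)
    have "u - x + (u' - u) = u' - x" "u - y + (u' - u) = u' - y" using assms by (auto simp: hits_def)
    then show "u - x + (u' - u) \<in> Rel S" "u - y + (u' - u) \<in> Rel S" using assms by (auto simp: hits_def)
  qed
  then show ?thesis using assms by (auto simp: hits_def)
qed

text \<open>Bonferroni: a single round is hit with probability at least \<open>m / (4 * F)\<close>,
  a pair of rounds with probability at most \<open>1 / F\<close>. For \<open>U\<close> small against
  \<open>m\<close> the hitting probability is thus of order \<open>card U * m / F\<close>.\<close>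

lemma pav_hits_union:
  assumes "U \<subseteq> main"
  shows "real (card U) * (real m / 4 - real (card U)) / real F \<le> pav (\<lambda>x S. \<exists>u\<in>U. hits u x S)"
proof -
  have fin: "finite U" using finite_subset[OF assms] by simp
  define G where "G = (\<lambda>x u. {S \<in> space A. hits u x S})"
  have G: "G x u \<in> sets A" for x u unfolding G_def by measurable
  \<comment> \<open>For a fixed drawn set, \<open>hits_sidon\<close> leaves at most one activation
    time that hits both rounds.\<close>
  have pair: "(\<Sum>x\<in>window. measure A (G x u \<inter> G x u')) \<le> 1" if ne: "u \<noteq> u'" for u u'
  proof -
    have "(\<Sum>x\<in>window. measure A (G x u \<inter> G x u')) \<le> real 1 * measure A (space A)"
    proof (rule sum_measure_le_multiplicity)
      fix S assume "S \<in> space A"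
      have "\<forall>x\<in>{x \<in> window. S \<in> G x u \<inter> G x u'}. \<forall>y\<in>{x \<in> window. S \<in> G x u \<inter> G x u'}. x = y"
        using hits_sidon[of u _ S u'] hits_sidon[of u' _ S u] ne by (auto simp: G_def neq_iff)
      then show "card {x \<in> window. S \<in> G x u \<inter> G x u'} \<le> 1"
        by (subst card_le_Suc0_iff_eq[unfolded One_nat_def[symmetric]]) auto
    qed (use G in \<open>auto simp: G_def\<close>)
    then show ?thesis by (simp add: prob_space)
  qed
  have UN: "{S \<in> space A. \<exists>u\<in>U. hits u x S} = (\<Union>u\<in>U. G x u)" for x by (auto simp: G_def)
  have "(\<Sum>x\<in>window. (\<Sum>u\<in>U. measure A (G x u)) - (\<Sum>u\<in>U. \<Sum>u'\<in>U - {u}. measure A (G x u \<inter> G x u')))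
      \<le> (\<Sum>x\<in>window. measure A {S \<in> space A. \<exists>u\<in>U. hits u x S})"
    unfolding UN using fin G by (intro sum_mono measure_UN_ge_Bonferroni) auto
  moreover have "(\<Sum>x\<in>window. \<Sum>u\<in>U. measure A (G x u)) \<ge> real (card U) * (real m / 4)"
  proof -
    have "(\<Sum>x\<in>window. measure A (G x u)) \<ge> real m / 4" if "u \<in> U" for u
      using pav_hits[of u] that assms Rel_mass F_pos by (auto simp: pav_def G_def)
    then have "(\<Sum>u\<in>U. \<Sum>x\<in>window. measure A (G x u)) \<ge> real (card U) * (real m / 4)"
      by (intro sum_bounded_below) auto
    then show ?thesis by (subst sum.swap)
  qed
  moreover have "(\<Sum>x\<in>window. \<Sum>u\<in>U. \<Sum>u'\<in>U - {u}. measure A (G x u \<inter> G x u')) \<le> real (card U) * real (card U)"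
  proof -
    have "(\<Sum>u\<in>U. \<Sum>u'\<in>U - {u}. \<Sum>x\<in>window. measure A (G x u \<inter> G x u')) \<le> (\<Sum>u\<in>U. \<Sum>u'\<in>U - {u}. 1)"
      by (intro sum_mono pair) auto
    also have "\<dots> \<le> (\<Sum>u\<in>U. real (card U))"
      using fin by (intro sum_mono) (simp add: card_Diff1_le)
    finally have "(\<Sum>u\<in>U. \<Sum>u'\<in>U - {u}. \<Sum>x\<in>window. measure A (G x u \<inter> G x u')) \<le> real (card U) * real (card U)" by simp
    moreover have "(\<Sum>x\<in>window. \<Sum>u\<in>U. \<Sum>u'\<in>U - {u}. measure A (G x u \<inter> G x u'))
        = (\<Sum>u\<in>U. \<Sum>x\<in>window. \<Sum>u'\<in>U - {u}. measure A (G x u \<inter> G x u'))" by (rule sum.swap)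
    moreover have "\<dots> = (\<Sum>u\<in>U. \<Sum>u'\<in>U - {u}. \<Sum>x\<in>window. measure A (G x u \<inter> G x u'))"
      by (intro sum.cong refl sum.swap)
    ultimately show ?thesis by simp
  qed
  ultimately have "real (card U) * (real m / 4 - real (card U))
      \<le> (\<Sum>x\<in>window. measure A {S \<in> space A. \<exists>u\<in>U. hits u x S})"
    by (simp add: sum_subtractf algebra_simps)
  then show ?thesis unfolding pav_def by (intro divide_right_mono) auto
qed

text \<open>Put \<open>r = v - x\<close>; it is at most \<open>T\<close> because
  \<open>v < u\<close> and \<open>u - x\<close> is a relevant attempt. For a fixed drawn set and a
  fixed \<open>r\<close> there remain at most \<open>m\<close> activation times, one for each
  relevant attempt that can land in \<open>u\<close>.\<close>

lemma pav_link_sum: "(\<Sum>v\<in>main. pav (link u v)) \<le> real m * load / real F"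
proof -
  have x: "(\<Sum>v\<in>main. measure A {S \<in> space A. link u v x S})
      \<le> (\<Sum>r=1..T. measure A {S \<in> space A. hits u x S \<and> r \<in> S})" for x
  proof -
    have "(\<Sum>v\<in>main. measure A {S \<in> space A. link u v x S})
        \<le> (\<Sum>v\<in>(+) x ` {1..T}. measure A {S \<in> space A. link u v x S})"
    proof (rule sum_le_sum_superset_vanish)
      fix v assume v: "v \<notin> (+) x ` {1..T}"
      have "\<not> link u v x S" if S: "S \<in> space A" for S
      proof
        assume l: "link u v x S"
        then have "u - x \<le> T" "v - x \<in> {1..}" using Rel_subset[of S] S
          by (auto simp: link_def hits_def space_A)
        then have "v - x \<in> {1..T}" "v = x + (v - x)" using l by (auto simp: link_def)
        then show False using v by blast
      qed
      then have "{S \<in> space A. link u v x S} = {}" by blast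
      then show "measure A {S \<in> space A. link u v x S} = 0" by (simp only: measure_empty)
    qed auto
    also have "\<dots> = (\<Sum>r=1..T. measure A {S \<in> space A. link u (x + r) x S})"
      by (subst sum.reindex) auto
    also have "\<dots> \<le> (\<Sum>r=1..T. measure A {S \<in> space A. hits u x S \<and> r \<in> S})"
      by (intro sum_mono finite_measure_mono) (auto simp: link_def)
    finally show ?thesis .
  qed
  have "(\<Sum>v\<in>main. \<Sum>x\<in>window. measure A {S \<in> space A. link u v x S})
      = (\<Sum>x\<in>window. \<Sum>v\<in>main. measure A {S \<in> space A. link u v x S})" by (rule sum.swap)
  also have "\<dots> \<le> (\<Sum>x\<in>window. \<Sum>r=1..T. measure A {S \<in> space A. hits u x S \<and> r \<in> S})"
    by (intro sum_mono x)
  also have "\<dots> = (\<Sum>r=1..T. \<Sum>x\<in>window. measure A {S \<in> space A. hits u x S \<and> r \<in> S})" by (rule sum.swap)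
  also have "\<dots> \<le> (\<Sum>r=1..T. real m * measure A {S \<in> space A. r \<in> S})"
  proof (intro sum_mono sum_measure_le_multiplicity)
    fix r S assume "S \<in> {S \<in> space A. r \<in> S}"
    have "card {x \<in> window. S \<in> {S \<in> space A. hits u x S \<and> r \<in> S}} \<le> card (Rel S)"
    proof (rule card_inj_on_le)
      show "inj_on (\<lambda>x. u - x) {x \<in> window. S \<in> {S \<in> space A. hits u x S \<and> r \<in> S}}"
        by (auto simp: inj_on_def hits_def)
      show "finite (Rel S)" using Rel_subset finite_subset by blast
    qed (auto simp: hits_def)
    then show "card {x \<in> window. S \<in> {S \<in> space A. hits u x S \<and> r \<in> S}} \<le> m"
      using card_Rel[of S] by simp
  qed auto
  also have "\<dots> = real m * load" by (simp add: load_def sum_distrib_left)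
  finally show ?thesis unfolding pav_def sum_divide_distrib[symmetric]
    by (intro divide_right_mono) auto
qed

text \<open>The chain condition split into requirements on single stations, so that independence
  applies: the candidate parent rounds are read off the fixed list, not off the draws of
  others.\<close>

primrec entry :: "nat \<Rightarrow> (nat \<times> nat) list \<Rightarrow> nat \<Rightarrow> nat \<Rightarrow> nat set \<Rightarrow> bool" where
  "entry t [] i x S \<longleftrightarrow> True"
| "entry t (y # zs) i x S \<longleftrightarrow>
     (if i = fst y then \<exists>u\<in>insert t (snd ` set zs). link u (snd y) x S else entry t zs i x S)"

text \<open>For an unlisted station this is the completeness clause of \<open>cluster\<close>: no
  relevant attempt in any listed success round.\<close>

definition listed :: "nat \<Rightarrow> (nat \<times> nat) list \<Rightarrow> nat \<Rightarrow> nat \<Rightarrow> nat set \<Rightarrow> bool" where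
  "listed t xs i x S \<longleftrightarrow>
     (if i \<in> fst ` set xs then entry t xs i x S else \<not> (\<exists>u\<in>snd ` set xs. hits u x S))"

definition listings :: "nat \<Rightarrow> (nat \<times> nat) list set" where
  "listings n = {xs. length xs = n \<and> set xs \<subseteq> {..<N} \<times> main \<and> distinct (map fst xs) \<and> distinct (map snd xs)}"

text \<open>A union bound over the possible parents of each entry, in a product form that can be
  summed entry by entry.\<close>

primrec weight :: "nat \<Rightarrow> (nat \<times> nat) list \<Rightarrow> real" where
  "weight t [] = 1"
| "weight t (y # zs) = (\<Sum>u\<in>insert t (snd ` set zs). pav (link u (snd y))) * weight t zs"

lemma entry_meas [measurable]: "Measurable.pred A (\<lambda>S. entry t xs i x S)"
proof (induction xs)
  case (Cons y zs)
  have [measurable]: "Measurable.pred A (\<lambda>S. \<exists>u\<in>insert t (snd ` set zs). link u (snd y) x S)"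
    by (intro pred_intros_finite) auto
  show ?case using Cons by (cases "i = fst y") simp_all
qed simp

lemma listed_meas [measurable]: "Measurable.pred A (\<lambda>S. listed t xs i x S)"
proof -
  have [measurable]: "Measurable.pred A (\<lambda>S. \<exists>u\<in>snd ` set xs. hits u x S)"
    by (intro pred_intros_finite) auto
  show ?thesis unfolding listed_def by measurable
qed

lemma weight_nonneg: "0 \<le> weight t xs"
  by (induction xs) (auto intro!: mult_nonneg_nonneg sum_nonneg pav_nonneg)

lemma prod_entry_le_weight:
  "distinct (map fst xs) \<Longrightarrow> (\<Prod>i\<in>fst ` set xs. pav (entry t xs i)) \<le> weight t xs"
proof (induction xs)
  case (Cons y zs)
  have y: "fst y \<notin> fst ` set zs" using Cons.prems by auto
  have "(\<Prod>i\<in>fst ` set (y # zs). pav (entry t (y # zs) i)) =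
        pav (entry t (y # zs) (fst y)) * (\<Prod>i\<in>fst ` set zs. pav (entry t (y # zs) i))"
    using y by simp
  also have "(\<Prod>i\<in>fst ` set zs. pav (entry t (y # zs) i)) = (\<Prod>i\<in>fst ` set zs. pav (entry t zs i))"
  proof (rule prod.cong)
    fix i assume "i \<in> fst ` set zs"
    then have "i \<noteq> fst y" using y by metis
    then have "entry t (y # zs) i = entry t zs i" by (intro ext) simp
    then show "pav (entry t (y # zs) i) = pav (entry t zs i)" by simp
  qed simp
  also have "pav (entry t (y # zs) (fst y)) \<le> (\<Sum>u\<in>insert t (snd ` set zs). pav (link u (snd y)))"
  proof -
    have "entry t (y # zs) (fst y) = (\<lambda>x S. \<exists>u\<in>insert t (snd ` set zs). link u (snd y) x S)"
      by (intro ext) simp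
    then show ?thesis using pav_Bex_le[of "insert t (snd ` set zs)" "\<lambda>u. link u (snd y)"] by simp
  qed
  also have "(\<Sum>u\<in>insert t (snd ` set zs). pav (link u (snd y))) * (\<Prod>i\<in>fst ` set zs. pav (entry t zs i))
      \<le> (\<Sum>u\<in>insert t (snd ` set zs). pav (link u (snd y))) * weight t zs"
    using Cons by (intro mult_left_mono sum_nonneg pav_nonneg) auto
  finally show ?case by (simp add: mult_right_mono prod_nonneg pav_nonneg)
qed simp

lemma finite_lists_of: "finite {xs. set xs \<subseteq> {..<N} \<times> main \<and> length xs = n}"
  by (intro finite_lists_length_eq) auto

lemma finite_listings: "finite (listings n)"
  by (rule finite_subset[OF _ finite_lists_of[of n]]) (auto simp: listings_def)

text \<open>Peel off the head: \<open>N\<close> choices of its station, at most \<open>b\<close>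
  choices of its parent, and \<open>pav_link_sum\<close> for its success round. The sum ignores the
  distinctness demanded by \<open>listings\<close>, so that head and tail vary
  independently.\<close>

lemma sum_weight_le:
  assumes "n \<le> b"
  shows "(\<Sum>xs | set xs \<subseteq> {..<N} \<times> main \<and> length xs = n. weight t xs)
           \<le> (real N * real b * (real m * load / real F)) ^ n"
  using assms
proof (induction n)
  case 0
  have "{xs. set xs \<subseteq> {..<N} \<times> main \<and> length xs = 0} = {[]}" by auto
  then show ?case by simp
next
  case (Suc n)
  define L where "L = {xs. set xs \<subseteq> {..<N} \<times> main \<and> length xs = n}"
  define q where "q = real m * load / real F"
  have q: "q \<ge> 0" unfolding q_def using load_nonneg by simp
  have finL: "finite L" unfolding L_def by (rule finite_lists_of)
  have eq: "{xs. set xs \<subseteq> {..<N} \<times> main \<and> length xs = Suc n} = (\<lambda>(y, zs). y # zs) ` (({..<N} \<times> main) \<times> L)"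
    by (auto simp: L_def length_Suc_conv image_iff)
  have step: "(\<Sum>y\<in>{..<N} \<times> main. \<Sum>u\<in>insert t (snd ` set zs). pav (link u (snd y))) \<le> real N * real b * q"
    if "zs \<in> L" for zs
  proof -
    have "card (insert t (snd ` set zs)) \<le> Suc (length zs)"
      by (metis card_image_le card_insert_le_m1 card_length diff_Suc_1 dual_order.trans finite_set zero_less_Suc)
    then have card: "card (insert t (snd ` set zs)) \<le> b" using that Suc.prems by (simp add: L_def)
    have "(\<Sum>y\<in>{..<N} \<times> main. \<Sum>u\<in>insert t (snd ` set zs). pav (link u (snd y)))
        = (\<Sum>i<N. \<Sum>v\<in>main. \<Sum>u\<in>insert t (snd ` set zs). pav (link u v))"
      by (subst sum.cartesian_product) (intro sum.cong; auto)
    also have "\<dots> = real N * (\<Sum>u\<in>insert t (snd ` set zs). \<Sum>v\<in>main. pav (link u v))"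
      by (subst sum.swap) simp
    also have "\<dots> \<le> real N * (\<Sum>u\<in>insert t (snd ` set zs). q)"
      unfolding q_def by (intro mult_left_mono sum_mono pav_link_sum) auto
    also have "\<dots> = real N * (real (card (insert t (snd ` set zs))) * q)" by simp
    also have "\<dots> \<le> real N * (real b * q)" using card q by (intro mult_left_mono mult_right_mono) auto
    finally show ?thesis by (simp add: mult.assoc)
  qed
  have "(\<Sum>xs | set xs \<subseteq> {..<N} \<times> main \<and> length xs = Suc n. weight t xs)
      = (\<Sum>(y, zs)\<in>({..<N} \<times> main) \<times> L. weight t (y # zs))"
    unfolding eq by (subst sum.reindex) (auto simp: inj_on_def case_prod_beta)
  also have "\<dots> = (\<Sum>zs\<in>L. \<Sum>y\<in>{..<N} \<times> main. (\<Sum>u\<in>insert t (snd ` set zs). pav (link u (snd y))) * weight t zs)"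
    by (subst sum.cartesian_product[symmetric], subst sum.swap) simp
  also have "\<dots> = (\<Sum>zs\<in>L. (\<Sum>y\<in>{..<N} \<times> main. \<Sum>u\<in>insert t (snd ` set zs). pav (link u (snd y))) * weight t zs)"
    by (simp only: sum_distrib_right)
  also have "\<dots> \<le> (\<Sum>zs\<in>L. (real N * real b * q) * weight t zs)"
    by (intro sum_mono mult_right_mono step weight_nonneg)
  also have "\<dots> = (real N * real b * q) * (\<Sum>zs\<in>L. weight t zs)" by (simp add: sum_distrib_left)
  also have "\<dots> \<le> (real N * real b * q) * (real N * real b * q) ^ n"
    using Suc q by (intro mult_left_mono mult_nonneg_nonneg) (auto simp: q_def L_def)
  finally show ?case by (simp add: q_def)
qed

text \<open>Listed stations contribute \<open>weight\<close>. At least \<open>N / 2\<close> others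
  have to avoid \<open>n\<close> rounds, each with probability at most
  \<open>1 - n * m / (8 * F)\<close>; together this is a factor
  \<open>exp (- N * m / (16 * F))\<close> for every entry.\<close>

lemma prod_listed_le:
  assumes xs: "xs \<in> listings n" and n: "8 * n \<le> m" "2 * n \<le> N"
  shows "(\<Prod>i<N. pav (listed t xs i)) \<le> weight t xs * exp (- (real N * real m / (16 * real F))) ^ n"
proof -
  define I where "I = fst ` set xs"
  define U where "U = snd ` set xs"
  define p where "p = pav (\<lambda>x S. \<exists>u\<in>U. hits u x S)"
  have xs': "length xs = n" "set xs \<subseteq> {..<N} \<times> main" "distinct (map fst xs)" "distinct (map snd xs)"
    using xs by (auto simp: listings_def)
  have cardI: "card I = n" unfolding I_def using xs' by (metis distinct_card length_map list.set_map)
  have cardU: "card U = n" unfolding U_def using xs' by (metis distinct_card length_map list.set_map)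
  have I: "I \<subseteq> {..<N}" and U: "U \<subseteq> main" using xs'(2) by (auto simp: I_def U_def)
  \<comment> \<open>\<open>8 * n \<le> m\<close> keeps the Bonferroni correction below half of the
    main term.\<close>
  have "real n * (real m / 8) \<le> real n * (real m / 4 - real n)"
    using n(1) by (intro mult_left_mono) auto
  then have "real n * (real m / 8) / real F \<le> real n * (real m / 4 - real n) / real F"
    by (intro divide_right_mono) auto
  also have "\<dots> \<le> p" unfolding p_def using pav_hits_union[OF U] cardU by simp
  finally have p: "real n * (real m / 8) / real F \<le> p" .
  have p1: "p \<le> 1" "p \<ge> 0" unfolding p_def by (rule pav_le_1 pav_nonneg)+
  have "(\<Prod>i<N. pav (listed t xs i)) = (\<Prod>i\<in>I. pav (listed t xs i)) * (\<Prod>i\<in>{..<N} - I. pav (listed t xs i))"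
    using I by (subst prod.subset_diff[OF I]) (auto simp: mult.commute)
  also have "(\<Prod>i\<in>I. pav (listed t xs i)) = (\<Prod>i\<in>fst ` set xs. pav (entry t xs i))"
  proof (rule prod.cong)
    fix i assume "i \<in> fst ` set xs"
    then have "listed t xs i = entry t xs i" by (intro ext) (simp add: listed_def)
    then show "pav (listed t xs i) = pav (entry t xs i)" by simp
  qed (simp add: I_def)
  also have "(\<Prod>i\<in>{..<N} - I. pav (listed t xs i)) = (\<Prod>i\<in>{..<N} - I. 1 - p)"
  proof (rule prod.cong)
    fix i assume "i \<in> {..<N} - I"
    then have "listed t xs i = (\<lambda>x S. \<not> (\<exists>u\<in>U. hits u x S))"
      by (intro ext) (auto simp: listed_def I_def U_def)
    moreover have "Measurable.pred A (\<lambda>S. \<exists>u\<in>U. hits u x S)" for x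
      unfolding U_def by (intro pred_intros_finite) auto
    ultimately show "pav (listed t xs i) = 1 - p" unfolding p_def by (simp only: pav_not)
  qed simp
  also have "\<dots> = (1 - p) ^ (N - n)" using I cardI by (simp add: card_Diff_subset finite_subset[OF I])
  also have "(\<Prod>i\<in>fst ` set xs. pav (entry t xs i)) * (1 - p) ^ (N - n) \<le>
      weight t xs * exp (- (real N * real m / (16 * real F))) ^ n"
  proof (rule mult_mono)
    show "(\<Prod>i\<in>fst ` set xs. pav (entry t xs i)) \<le> weight t xs" using xs' by (intro prod_entry_le_weight)
    have "(1 - p) ^ (N - n) \<le> exp (- p) ^ (N - n)"
      using p1 exp_ge_add_one_self[of "- p"] by (intro power_mono) auto
    also have "\<dots> = exp (- (real (N - n) * p))" by (simp add: exp_of_nat_mult[symmetric])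
    also have "\<dots> \<le> exp (- (real n * (real N * real m / (16 * real F))))"
    proof -
      have "real n * (real N * real m / (16 * real F)) = (real N / 2) * (real n * (real m / 8) / real F)"
        by (simp add: field_simps)
      also have "\<dots> \<le> real (N - n) * p" using n(2) p by (intro mult_mono) auto
      finally show ?thesis by simp
    qed
    also have "\<dots> = exp (- (real N * real m / (16 * real F))) ^ n"
      by (simp add: exp_of_nat_mult[symmetric])
    finally show "(1 - p) ^ (N - n) \<le> exp (- (real N * real m / (16 * real F))) ^ n" .
  qed (use p1 weight_nonneg in auto)
  finally show ?thesis .
qed

lemma sum_listed_le:
  assumes "n \<le> b" "8 * n \<le> m" "2 * n \<le> N"
  shows "(\<Sum>xs\<in>listings n. \<Prod>i<N. pav (listed t xs i))
     \<le> (real N * real b * (real m * load / real F) * exp (- (real N * real m / (16 * real F)))) ^ n"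
proof -
  have "(\<Sum>xs\<in>listings n. \<Prod>i<N. pav (listed t xs i))
      \<le> (\<Sum>xs\<in>listings n. weight t xs * exp (- (real N * real m / (16 * real F))) ^ n)"
    using assms by (intro sum_mono prod_listed_le)
  also have "\<dots> = (\<Sum>xs\<in>listings n. weight t xs) * exp (- (real N * real m / (16 * real F))) ^ n"
    by (simp add: sum_distrib_right)
  also have "(\<Sum>xs\<in>listings n. weight t xs) \<le> (\<Sum>xs | set xs \<subseteq> {..<N} \<times> main \<and> length xs = n. weight t xs)"
    using finite_lists_of weight_nonneg by (intro sum_mono2) (auto simp: listings_def)
  also have "\<dots> \<le> (real N * real b * (real m * load / real F)) ^ n"
    using assms(1) by (rule sum_weight_le)
  finally show ?thesis unfolding power_mult_distrib[of _ "exp _"] by (simp add: mult_right_mono)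
qed

end

section \<open>Jammers, test stations, and bounds on the probability of success\<close>

section \<open>The adversarial instance\<close>

definition first_at :: "nat \<Rightarrow> nat set \<Rightarrow> bool" where
  "first_at d S \<longleftrightarrow> d \<in> S \<and> (\<forall>r<d. r \<notin> S)"

text \<open>Stations \<open>i < N\<close> form the stream with the activation times \<open>\<alpha>\<close>. They are followed by \<open>2 * T\<close>
  blocks of \<open>b\<close> jammers, two blocks for each of the rounds \<open>d + 1, \<dots>, d + T\<close>; all other stations are
  activated in round \<open>d\<close>.\<close>

definition activation :: "nat \<Rightarrow> nat \<Rightarrow> nat \<Rightarrow> nat \<Rightarrow> (nat \<Rightarrow> nat) \<Rightarrow> nat \<Rightarrow> nat" where
  "activation d T N b \<alpha> i =
     (if i < N then \<alpha> i else if i < N + 2 * T * b then (i - N) div b div 2 + 1 else d)"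

abbreviation jammer_block :: "nat \<Rightarrow> nat \<Rightarrow> nat \<Rightarrow> nat set" where
  "jammer_block N b h \<equiv> {N + h * b..<N + h * b + b}"

text \<open>Two jammers from different blocks make their first attempt in round \<open>t\<close>,
  and at least one of them is not \<open>i\<close>. That one would need a success, hence an attempt,
  before its first attempt. This is why each round gets two blocks.\<close>

lemma jammed_round:
  assumes k: "N + 2 * T * b \<le> k"
    and first: "\<And>h. h < 2 * T \<Longrightarrow> \<exists>j\<in>jammer_block N b h. first_at d (S j)"
    and t: "d < t" "t \<le> d + T"
  shows "\<not> successful k (activation d T N b \<alpha>) S i t"
proof
  let ?a = "activation d T N b \<alpha>"
  assume suc: "successful k ?a S i t"
  have blk: "j < k \<and> N \<le> j \<and> ?a j = t - d \<and> (j - N) div b = h"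
    if j: "j \<in> jammer_block N b h" and h: "h < 2 * T" "h div 2 = t - d - 1" for h j
  proof -
    have b: "b > 0" using j by auto
    have "(h + 1) * b \<le> 2 * T * b" using h by (intro mult_right_mono) auto
    then have "N + h * b + b \<le> N + 2 * T * b" by (simp add: algebra_simps)
    then have jk: "j < N + 2 * T * b" using j by auto
    have "(j - N) div b = h"
      by (rule div_nat_eqI) (use j in \<open>auto simp: algebra_simps\<close>)
    then show ?thesis using j jk k h t by (auto simp: activation_def)
  qed
  \<comment> \<open>Blocks \<open>2 * h\<close> and \<open>2 * h + 1\<close> are activated in round
    \<open>h + 1\<close>, so a first attempt in local round \<open>d\<close> falls into the global
    round \<open>h + 1 + d = t\<close>.\<close>
  define h where "h = t - d - 1"
  have h: "h < T" using t by (auto simp: h_def)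
  obtain j1 where j1: "j1 \<in> jammer_block N b (2 * h)" "first_at d (S j1)"
    using first[of "2 * h"] h by auto
  obtain j2 where j2: "j2 \<in> jammer_block N b (2 * h + 1)" "first_at d (S j2)"
    using first[of "2 * h + 1"] h by auto
  have b1: "j1 < k \<and> N \<le> j1 \<and> ?a j1 = t - d \<and> (j1 - N) div b = 2 * h"
    by (rule blk[OF j1(1)]) (use h in \<open>auto simp: h_def\<close>)
  have b2: "j2 < k \<and> N \<le> j2 \<and> ?a j2 = t - d \<and> (j2 - N) div b = 2 * h + 1"
    by (rule blk[OF j2(1)]) (use h in \<open>auto simp: h_def\<close>)
  have "2 * h \<noteq> 2 * h + 1" by simp
  then have "j1 \<noteq> j2" using b1 b2 by metis
  then obtain j where j: "j \<noteq> i" "j < k" "?a j = t - d" "first_at d (S j)"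
    using b1 b2 j1(2) j2(2) by metis
  then obtain t' where t': "t' < t" "successful k ?a S j t'"
    using successful_others_off[OF suc, of j] t by (auto simp: first_at_def)
  then have "?a j \<le> t'" "t' - ?a j \<in> S j" by (auto dest: successfulD)
  then show False using j t' t by (auto simp: first_at_def)
qed

text \<open>Tests start in round \<open>d\<close>. Local round 0 is no attempt and the next
  \<open>T\<close> rounds are jammed, so the tests occupy distinct later rounds.\<close>

lemma successes_ge_tests:
  assumes k: "N + 2 * T * b \<le> k"
    and sub: "\<And>i. i < k \<Longrightarrow> S i \<subseteq> {1..}"
    and jam: "\<And>i t. d < t \<Longrightarrow> t \<le> d + T \<Longrightarrow> \<not> successful k (activation d T N b \<alpha>) S i t"
    and all: "all_succeed_within k (activation d T N b \<alpha>) S (real F)"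
  shows "k - (N + 2 * T * b) \<le> card {t \<in> {d + T<..d + F}. \<exists>i. successful k (activation d T N b \<alpha>) S i t}"
proof -
  let ?a = "activation d T N b \<alpha>"
  define I where "I = {N + 2 * T * b..<k}"
  have "\<exists>t. successful k ?a S i t \<and> t \<in> {d + T<..d + F}" if i: "i \<in> I" for i
  proof -
    have ai: "?a i = d" "i < k" using i by (auto simp: I_def activation_def)
    obtain t where t: "successful k ?a S i t" "real t - real (?a i) \<le> real F"
      using all ai(2) unfolding all_succeed_within_def by blast
    then have "d \<le> t" "t - d \<in> S i" using ai successfulD[OF t(1)] by auto
    then have "d < t" using sub[OF ai(2)] by auto
    then have "d + T < t" using jam[of t i] t(1) by (meson not_le)
    then show ?thesis using t ai by (intro exI[of _ t]) auto
  qed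
  then obtain \<tau> where \<tau>: "\<And>i. i \<in> I \<Longrightarrow> successful k ?a S i (\<tau> i) \<and> \<tau> i \<in> {d + T<..d + F}" by metis
  have "inj_on \<tau> I" using \<tau> by (intro inj_onI) (metis successful_station_unique)
  then have "card I \<le> card {t \<in> {d + T<..d + F}. \<exists>i. successful k ?a S i t}"
    using \<tau> by (intro card_inj_on_le[of \<tau>]) auto
  then show ?thesis by (simp add: I_def)
qed

context nonadaptive
begin

abbreviation drawn :: "nat \<Rightarrow> (nat \<Rightarrow> nat set) measure" where
  "drawn k \<equiv> Pi\<^sub>M {..<k} (\<lambda>_. A)"

lemma drawn_subset: "S \<in> space (drawn k) \<Longrightarrow> i < k \<Longrightarrow> S i \<subseteq> {1..}"
  using space_A by (auto simp: space_PiM PiE_iff)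

lemma prob_space_drawn: "prob_space (drawn k)"
  by (intro prob_space_PiM prob_space_axioms)

lemma first_at_meas [measurable]: "Measurable.pred A (first_at d)"
  unfolding first_at_def by measurable

definition unjammed :: "nat \<Rightarrow> nat \<Rightarrow> nat \<Rightarrow> nat \<Rightarrow> nat \<Rightarrow> (nat \<Rightarrow> nat set) set" where
  "unjammed k d N b h = {S \<in> space (drawn k). \<forall>j\<in>jammer_block N b h. \<not> first_at d (S j)}"

lemma unjammed:
  assumes "N + 2 * T * b \<le> k" "h < 2 * T"
  shows "unjammed k d N b h \<in> sets (drawn k)"
    and "measure (drawn k) (unjammed k d N b h) = (1 - measure A {S \<in> space A. first_at d S}) ^ b"
proof -
  have "(h + 1) * b \<le> 2 * T * b" using assms(2) by (intro mult_right_mono) auto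
  then have sub: "jammer_block N b h \<subseteq> {..<k}" using assms(1) by auto
  show "unjammed k d N b h \<in> sets (drawn k)"
    unfolding unjammed_def by (intro pred_coord sub) measurable
  have "measure A {S \<in> space A. \<not> first_at d S} = 1 - measure A {S \<in> space A. first_at d S}"
    by (rule prob_neg) measurable
  then show "measure (drawn k) (unjammed k d N b h) = (1 - measure A {S \<in> space A. first_at d S}) ^ b"
    unfolding unjammed_def by (subst measure_coords[OF sub]) simp_all
qed

definition all_succeed :: "nat \<Rightarrow> (nat \<Rightarrow> nat) \<Rightarrow> nat \<Rightarrow> (nat \<Rightarrow> nat set) set" where
  "all_succeed k a F = {S \<in> space (drawn k). all_succeed_within k a S (real F)}"

lemma all_succeed_sets: "all_succeed k a F \<in> sets (drawn k)"
  unfolding all_succeed_def by (rule all_succeed_within_measurable[OF nonadaptive])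

end

context stream
begin

abbreviation act :: "nat \<Rightarrow> (nat \<Rightarrow> nat) \<Rightarrow> nat \<Rightarrow> nat" where
  "act b \<alpha> \<equiv> activation d T N b \<alpha>"

lemma act_stream: "i < N \<Longrightarrow> act b \<alpha> i = \<alpha> i"
  by (simp add: activation_def)

definition quiet :: "nat \<Rightarrow> (nat \<Rightarrow> nat) \<Rightarrow> nat set \<Rightarrow> nat \<Rightarrow> (nat \<Rightarrow> nat set) set" where
  "quiet k a I t = {S \<in> space (drawn k). \<forall>i\<in>I. \<not> hits t (a i) (S i)}"

lemma quiet_sets:
  assumes "I \<subseteq> {..<k}"
  shows "quiet k a I t \<in> sets (drawn k)"
  unfolding quiet_def using assms by (intro pred_coord) auto

lemma avg_quiet:
  assumes "N \<le> k" "I \<subseteq> {..<N}" "t \<in> main"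
  shows "avg (\<lambda>\<alpha>. measure (drawn k) (quiet k (act b \<alpha>) I t))
           = (1 - (\<Sum>r=1..T. measure A {S \<in> space A. r \<in> Rel S}) / real F) ^ card I"
proof -
  have "avg (\<lambda>\<alpha>. measure (drawn k) (quiet k (act b \<alpha>) I t)) = (\<Prod>i\<in>I. pav (\<lambda>x S. \<not> hits t x S))"
    unfolding quiet_def using assms by (intro avg_coords) (auto simp: act_stream)
  also have "\<dots> = (1 - pav (hits t)) ^ card I" by (subst pav_not) simp_all
  finally show ?thesis using pav_hits[OF assms(3)] by simp
qed

text \<open>Jamming confines the earlier success to \<open>main\<close>, so the descent never leaves
  the rounds on which hitting probabilities are known exactly.\<close>

lemma stream_off:
  assumes \<alpha>: "\<alpha> \<in> schedules" and k: "N \<le> k"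
    and sub: "\<And>i. i < k \<Longrightarrow> S i \<subseteq> {1..}"
    and jam: "\<And>i t. d < t \<Longrightarrow> t \<le> d + T \<Longrightarrow> \<not> successful k (act b \<alpha>) S i t"
    and suc: "successful k (act b \<alpha>) S i t" "t \<in> main" "j < N" "j \<noteq> i" "hits t (act b \<alpha> j) (S j)"
  shows "\<exists>t'<t. t' \<in> main \<and> successful k (act b \<alpha>) S j t'"
proof -
  have "act b \<alpha> j \<le> t" "t - act b \<alpha> j \<in> S j"
    using suc(5) Rel_subset[of "S j"] by (auto simp: hits_def)
  then obtain t' where t': "t' < t" "successful k (act b \<alpha>) S j t'"
    using successful_others_off[OF suc(1), of j] suc(3,4) k by auto
  have "\<alpha> j \<in> window" using \<alpha> suc(3) by (auto simp: schedules_def)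
  then have "d \<le> \<alpha> j" by (simp add: window_def)
  moreover have "\<alpha> j \<le> t'" "t' - \<alpha> j \<in> S j"
    using successfulD[OF t'(2)] suc(3) by (auto simp: act_stream)
  moreover have "S j \<subseteq> {1..}" using sub suc(3) k by auto
  ultimately have "d < t'" by fastforce
  then have "d + T < t'" using jam[of t' j] t'(2) by (meson not_le)
  then show ?thesis using t' suc(2) by (intro exI[of _ t']) (auto simp: main_def)
qed

text \<open>Descend to a success whose round is hit by no stream station except possibly its winner.
  The winner lies in at most one of two disjoint groups, so the other group is quiet and no union
  bound over the winner is needed.\<close>

lemma quiet_first_success:
  assumes \<alpha>: "\<alpha> \<in> schedules" and k: "N \<le> k" and S: "S \<in> space (drawn k)"
    and jam: "\<And>i t. d < t \<Longrightarrow> t \<le> d + T \<Longrightarrow> \<not> successful k (act b \<alpha>) S i t"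
    and "successful k (act b \<alpha>) S i t" "t \<in> main" and "I \<union> I' \<subseteq> {..<N}" "I \<inter> I' = {}"
  shows "\<exists>t\<in>main. S \<in> quiet k (act b \<alpha>) I t \<union> quiet k (act b \<alpha>) I' t"
  using assms(5,6)
proof (induction t arbitrary: i rule: less_induct)
  case (less t)
  show ?case
  proof (cases "\<exists>j<N. j \<noteq> i \<and> hits t (act b \<alpha> j) (S j)")
    case True
    then show ?thesis
      using stream_off[OF \<alpha> k drawn_subset[OF S] jam less.prems] less.IH by blast
  next
    case False
    then have "S \<in> quiet k (act b \<alpha>) I t \<union> quiet k (act b \<alpha>) I' t"
      using S assms(7,8) by (auto simp: quiet_def) (metis Int_iff empty_iff lessThan_iff subset_eq)+
    then show ?thesis using less.prems by blast
  qed
qed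

end

section \<open>The dense case: every round is busy with high probability\<close>

context stream
begin

lemma sum_unjammed:
  assumes "N + 2 * T * b \<le> k"
  shows "(\<Sum>h<2 * T. measure (drawn k) (unjammed k d N b h))
           = 2 * real T * (1 - measure A {S \<in> space A. first_at d S}) ^ b"
  using unjammed(2)[OF assms] by simp

lemma unjammed_or_jammed:
  assumes "N + 2 * T * b \<le> k" "S \<in> space (drawn k)"
  shows "S \<in> (\<Union>h<2 * T. unjammed k d N b h) \<or>
         (\<forall>i t. d < t \<longrightarrow> t \<le> d + T \<longrightarrow> \<not> successful k (act b \<alpha>) S i t)"
proof (rule disjCI)
  assume "\<not> (\<forall>i t. d < t \<longrightarrow> t \<le> d + T \<longrightarrow> \<not> successful k (act b \<alpha>) S i t)"
  then obtain i t where t: "d < t" "t \<le> d + T" "successful k (act b \<alpha>) S i t" by blast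
  then have "\<not> (\<forall>h<2 * T. \<exists>j\<in>jammer_block N b h. first_at d (S j))"
    using jammed_round[OF assms(1) _ t(1,2)] by blast
  then show "S \<in> (\<Union>h<2 * T. unjammed k d N b h)"
    using assms(2) by (auto simp: unjammed_def)
qed

lemma card_main_le: "real (card main) \<le> real F"
  by (simp add: main_def)

text \<open>If everybody succeeds, either a block of jammers has failed or one half of the stream is
  quiet in some round of \<open>main\<close>. A union bound covers both.\<close>

lemma success_prob_le_dense:
  assumes N: "N = 2 * N2" and k: "N + 2 * T * b < k" and TF: "T < F"
    and q: "\<And>\<alpha>. \<alpha> \<in> schedules \<Longrightarrow> q \<le> measure (drawn k) (all_succeed k (act b \<alpha>) F)"
  shows "q \<le> 2 * real T * (1 - measure A {S \<in> space A. first_at d S}) ^ b +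
    2 * real F * (1 - (\<Sum>r=1..T. measure A {S \<in> space A. r \<in> Rel S}) / real F) ^ N2"
proof -
  let ?I = "{..<N2}" and ?I' = "{N2..<N}"
  let ?p = "(\<Sum>r=1..T. measure A {S \<in> space A. r \<in> Rel S}) / real F"
  define u where "u = (\<Sum>h<2 * T. measure (drawn k) (unjammed k d N b h))"
  interpret P: prob_space "drawn k" by (rule prob_space_drawn)
  have I: "?I \<subseteq> {..<N}" "?I' \<subseteq> {..<N}" "?I \<subseteq> {..<k}" "?I' \<subseteq> {..<k}" using N k by auto
  have bound: "q \<le> u + (\<Sum>t\<in>main. measure (drawn k) (quiet k (act b \<alpha>) ?I t) +
      measure (drawn k) (quiet k (act b \<alpha>) ?I' t))" if \<alpha>: "\<alpha> \<in> schedules" for \<alpha>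
  proof -
    have sub: "all_succeed k (act b \<alpha>) F \<subseteq> (\<Union>h<2 * T. unjammed k d N b h) \<union>
        (\<Union>t\<in>main. quiet k (act b \<alpha>) ?I t \<union> quiet k (act b \<alpha>) ?I' t)"
    proof
      fix S assume "S \<in> all_succeed k (act b \<alpha>) F"
      then have S: "S \<in> space (drawn k)" "all_succeed_within k (act b \<alpha>) S (real F)"
        by (auto simp: all_succeed_def)
      show "S \<in> (\<Union>h<2 * T. unjammed k d N b h) \<union>
          (\<Union>t\<in>main. quiet k (act b \<alpha>) ?I t \<union> quiet k (act b \<alpha>) ?I' t)"
      proof (cases "S \<in> (\<Union>h<2 * T. unjammed k d N b h)")
        case False
        then have jam: "\<not> successful k (act b \<alpha>) S i t" if "d < t" "t \<le> d + T" for i t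
          using unjammed_or_jammed[of b k S \<alpha>] k S(1) that by auto
        \<comment> \<open>\<open>k\<close> exceeds the number of stream stations and jammers, so
          some test station exists and must succeed in \<open>main\<close>.\<close>
        have "0 < card {t \<in> {d + T<..d + F}. \<exists>i. successful k (act b \<alpha>) S i t}"
          using successes_ge_tests[OF _ drawn_subset[OF S(1)] jam S(2)] k by auto
        then obtain t i where "t \<in> main" "successful k (act b \<alpha>) S i t"
          by (auto simp: card_gt_0_iff main_def)
        then have "\<exists>t\<in>main. S \<in> quiet k (act b \<alpha>) ?I t \<union> quiet k (act b \<alpha>) ?I' t"
          using k I by (intro quiet_first_success[OF \<alpha> _ S(1) jam]) auto
        then show ?thesis by blast
      qed simp
    qed
    have "q \<le> measure (drawn k) (all_succeed k (act b \<alpha>) F)" by (rule q[OF \<alpha>])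
    also have "\<dots> \<le> measure (drawn k) ((\<Union>h<2 * T. unjammed k d N b h) \<union>
        (\<Union>t\<in>main. quiet k (act b \<alpha>) ?I t \<union> quiet k (act b \<alpha>) ?I' t))"
      using unjammed(1)[of N T b k] k quiet_sets[OF I(3)] quiet_sets[OF I(4)]
      by (intro P.finite_measure_mono[OF sub]) auto
    also have "\<dots> \<le> measure (drawn k) (\<Union>h<2 * T. unjammed k d N b h) +
        measure (drawn k) (\<Union>t\<in>main. quiet k (act b \<alpha>) ?I t \<union> quiet k (act b \<alpha>) ?I' t)"
      using unjammed(1)[of N T b k] k quiet_sets[OF I(3)] quiet_sets[OF I(4)]
      by (intro measure_Un_le) auto
    also have "\<dots> \<le> u + (\<Sum>t\<in>main. measure (drawn k) (quiet k (act b \<alpha>) ?I t \<union> quiet k (act b \<alpha>) ?I' t))"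
      unfolding u_def
      using unjammed(1)[of N T b k] k quiet_sets[OF I(3)] quiet_sets[OF I(4)]
      by (intro add_mono P.finite_measure_subadditive_finite) auto
    also have "\<dots> \<le> u + (\<Sum>t\<in>main. measure (drawn k) (quiet k (act b \<alpha>) ?I t) +
        measure (drawn k) (quiet k (act b \<alpha>) ?I' t))"
      using quiet_sets[OF I(3)] quiet_sets[OF I(4)]
      by (intro add_left_mono sum_mono measure_Un_le) auto
    finally show ?thesis .
  qed
  \<comment> \<open>\<open>q\<close> is a lower bound for every fixed schedule, so it may be
    compared with the average over all of them.\<close>
  have "q = avg (\<lambda>_. q)" by (simp add: avg_const)
  also have "\<dots> \<le> avg (\<lambda>\<alpha>. u + (\<Sum>t\<in>main. measure (drawn k) (quiet k (act b \<alpha>) ?I t) +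
      measure (drawn k) (quiet k (act b \<alpha>) ?I' t)))"
    by (intro avg_mono bound)
  also have "\<dots> = u + (\<Sum>t\<in>main. (1 - ?p) ^ N2 + (1 - ?p) ^ N2)"
    unfolding avg_add avg_sum avg_const using avg_quiet[of k _ _ b] I N k by simp
  also have "\<dots> = u + real (card main) * (2 * (1 - ?p) ^ N2)" by simp
  also have "\<dots> \<le> u + real F * (2 * (1 - ?p) ^ N2)"
  proof -
    \<comment> \<open>Any round of \<open>main\<close> shows that \<open>?p\<close> is a
      probability, which makes the power of \<open>1 - ?p\<close> nonnegative.\<close>
    have "d + F \<in> main" using TF by (simp add: main_def)
    then have "?p \<le> 1" using pav_hits[of "d + F"] pav_le_1[of "hits (d + F)"] by simp
    then show ?thesis using card_main_le by (intro add_left_mono mult_right_mono) auto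
  qed
  finally show ?thesis using sum_unjammed[of b k] k by (simp add: u_def)
qed

end

section \<open>The sparse case: clusters as random events\<close>

context sidon_stream
begin

definition listing_event :: "nat \<Rightarrow> (nat \<Rightarrow> nat) \<Rightarrow> nat \<Rightarrow> (nat \<times> nat) list \<Rightarrow> (nat \<Rightarrow> nat set) set" where
  "listing_event k a t xs = {S \<in> space (drawn k). \<forall>i\<in>{..<N}. listed t xs i (a i) (S i)}"

definition cluster_event :: "nat \<Rightarrow> (nat \<Rightarrow> nat) \<Rightarrow> nat \<Rightarrow> nat \<Rightarrow> (nat \<Rightarrow> nat set) set" where
  "cluster_event k a t n = (\<Union>xs\<in>listings n. listing_event k a t xs)"

lemma listing_event_sets: "N \<le> k \<Longrightarrow> listing_event k a t xs \<in> sets (drawn k)"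
  unfolding listing_event_def by (intro pred_coord) auto

lemma cluster_event_sets: "N \<le> k \<Longrightarrow> cluster_event k a t n \<in> sets (drawn k)"
  unfolding cluster_event_def using finite_listings listing_event_sets by auto

text \<open>Union bound over listings, then independence of the stations for each listing. The
  number of candidate parents is bounded by \<open>m\<close>.\<close>

lemma avg_cluster_event:
  assumes "N \<le> k" "n \<le> m" "8 * n \<le> m" "2 * n \<le> N"
  shows "avg (\<lambda>\<alpha>. measure (drawn k) (cluster_event k (act b \<alpha>) t n))
     \<le> (real N * real m * (real m * load / real F) * exp (- (real N * real m / (16 * real F)))) ^ n"
proof -
  interpret P: prob_space "drawn k" by (rule prob_space_drawn)
  have "avg (\<lambda>\<alpha>. measure (drawn k) (cluster_event k (act b \<alpha>) t n)) \<le>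
        avg (\<lambda>\<alpha>. \<Sum>xs\<in>listings n. measure (drawn k) (listing_event k (act b \<alpha>) t xs))"
    unfolding cluster_event_def using assms(1) finite_listings listing_event_sets
    by (intro avg_mono P.finite_measure_subadditive_finite) auto
  also have "\<dots> = (\<Sum>xs\<in>listings n. \<Prod>i<N. pav (listed t xs i))"
    unfolding avg_sum listing_event_def using assms(1)
    by (intro sum.cong avg_coords) (auto simp: act_stream)
  also have "\<dots> \<le> (real N * real m * (real m * load / real F) * exp (- (real N * real m / (16 * real F)))) ^ n"
    using assms by (intro sum_listed_le)
  finally show ?thesis .
qed

lemma chain_entry:
  "chain (\<lambda>i u v. link u v (a i) (S i)) t xs \<Longrightarrow> i \<in> fst ` set xs \<Longrightarrow> entry t xs i (a i) (S i)"
  by (induction xs) auto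

text \<open>The bridge from combinatorics to probability: a success is an attempt of the drawn set,
  so dependence within a cluster implies \<open>link\<close>.\<close>

lemma cluster_imp_event:
  assumes S: "S \<in> space (drawn k)"
    and cl: "cluster N main (\<lambda>i u. hits u (a i) (S i)) (successful k a S) t Q"
  shows "S \<in> cluster_event k a t (card Q)"
proof -
  have "\<exists>xs. chain (\<lambda>i u v. link u v (a i) (S i)) t xs \<and> length xs = card Q \<and>
      distinct (map fst xs) \<and> distinct (map snd xs) \<and> set xs \<subseteq> {..<N} \<times> main \<and>
      (\<forall>j<N. j \<notin> fst ` set xs \<longrightarrow> (\<forall>v\<in>snd ` set xs. \<not> hits v (a j) (S j)))"
  proof (rule cluster_chain[OF _ _ _ cl])
    show "\<And>i t t'. successful k a S i t \<Longrightarrow> successful k a S i t' \<Longrightarrow> t = t'"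
      by (rule successful_time_unique)
    show "\<And>i j t. successful k a S i t \<Longrightarrow> successful k a S j t \<Longrightarrow> i = j"
      by (rule successful_station_unique)
    show "\<And>i u v. hits u (a i) (S i) \<Longrightarrow> v < u \<Longrightarrow> successful k a S i v \<Longrightarrow> link u v (a i) (S i)"
      by (auto simp: link_def dest: successfulD)
  qed
  then obtain xs where xs: "chain (\<lambda>i u v. link u v (a i) (S i)) t xs" "xs \<in> listings (card Q)"
      "\<forall>j<N. j \<notin> fst ` set xs \<longrightarrow> (\<forall>v\<in>snd ` set xs. \<not> hits v (a j) (S j))"
    by (auto simp: listings_def)
  have "S \<in> listing_event k a t xs"
    unfolding listing_event_def using S chain_entry[OF xs(1)] xs(3) by (auto simp: listed_def)
  then show ?thesis using xs(2) unfolding cluster_event_def by blast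
qed

text \<open>Apart from large clusters, the cluster of \<open>t\<close> is either nonempty and small
  or empty. An empty one leaves only the winner with a possible relevant attempt in
  \<open>t\<close>, so one of the two groups is quiet.\<close>

lemma success_events:
  assumes \<alpha>: "\<alpha> \<in> schedules" and k: "N \<le> k" and S: "S \<in> space (drawn k)"
    and jam: "\<And>i t. d < t \<Longrightarrow> t \<le> d + T \<Longrightarrow> \<not> successful k (act b \<alpha>) S i t"
    and suc: "successful k (act b \<alpha>) S i t" "t \<in> main" and n: "n > 0"
    and I: "I \<union> I' \<subseteq> {..<N}" "I \<inter> I' = {}"
  shows "S \<in> (\<Union>t\<in>main. \<Union>l\<in>{n..<2 * n}. cluster_event k (act b \<alpha>) t l) \<or>
     S \<in> quiet k (act b \<alpha>) I t \<union> quiet k (act b \<alpha>) I' t \<union> (\<Union>l\<in>{1..<n}. cluster_event k (act b \<alpha>) t l)"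
proof -
  let ?cl = "cluster N main (\<lambda>i u. hits u (act b \<alpha> i) (S i)) (successful k (act b \<alpha>) S)"
  have "(\<exists>t'\<in>main. \<exists>Q. ?cl t' Q \<and> n \<le> card Q \<and> card Q < 2 * n) \<or>
      (\<exists>Q. ?cl t Q \<and> card Q < n \<and> (\<forall>j<N. j \<noteq> i \<longrightarrow> hits t (act b \<alpha> j) (S j) \<longrightarrow> j \<in> Q))"
    using stream_off[OF \<alpha> k drawn_subset[OF S] jam] n suc(2,1)
    by (rule success_cluster)
  then show ?thesis
  proof
    assume "\<exists>t'\<in>main. \<exists>Q. ?cl t' Q \<and> n \<le> card Q \<and> card Q < 2 * n"
    then obtain t' Q where t': "t' \<in> main" "?cl t' Q" "n \<le> card Q" "card Q < 2 * n" by blast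
    then have "card Q \<in> {n..<2 * n}" by simp
    then show ?thesis using cluster_imp_event[OF S t'(2)] t'(1) by blast
  next
    assume "\<exists>Q. ?cl t Q \<and> card Q < n \<and> (\<forall>j<N. j \<noteq> i \<longrightarrow> hits t (act b \<alpha> j) (S j) \<longrightarrow> j \<in> Q)"
    then obtain Q where Q: "?cl t Q" "card Q < n"
      "\<And>j. j < N \<Longrightarrow> j \<noteq> i \<Longrightarrow> hits t (act b \<alpha> j) (S j) \<Longrightarrow> j \<in> Q" by blast
    show ?thesis
    proof (cases "Q = {}")
      case True
      have "S \<in> quiet k (act b \<alpha>) I t \<union> quiet k (act b \<alpha>) I' t"
      proof (cases "i \<in> I")
        case True
        then have "\<forall>j\<in>I'. j < N \<and> j \<noteq> i" using I by auto
        then show ?thesis using Q(3) \<open>Q = {}\<close> S by (auto simp: quiet_def)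
      next
        case False
        then have "\<forall>j\<in>I. j < N \<and> j \<noteq> i" using I by auto
        then show ?thesis using Q(3) \<open>Q = {}\<close> S by (auto simp: quiet_def)
      qed
      then show ?thesis by blast
    next
      case False
      have "finite Q" using Q(1) finite_subset[of Q "{..<N}"] by (auto simp: cluster_def)
      then have "card Q \<in> {1..<n}" using False Q(2) by (simp add: Suc_le_eq card_gt_0_iff)
      then show ?thesis using cluster_imp_event[OF S Q(1)] by blast
    qed
  qed
qed

end

context sidon_stream
begin

text \<open>Large clusters are excluded in all rounds by a union bound. Then each success round is
  quiet for one half or carries a small nonempty cluster, and the tests need many such rounds;
  Markov's inequality divides the expected number of them by the number of tests.\<close>

lemma success_prob_le_sparse:
  assumes N: "N = 2 * N2" and k: "N + 2 * T * b < k" and TF: "T < F"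
    and n: "n > 0" "16 * n \<le> m" "4 * n \<le> N"
    and \<beta>: "\<beta> = real N * real m * (real m * load / real F) * exp (- (real N * real m / (16 * real F)))"
    and q: "\<And>\<alpha>. \<alpha> \<in> schedules \<Longrightarrow> q \<le> measure (drawn k) (all_succeed k (act b \<alpha>) F)"
  shows "q \<le> 2 * real T * (1 - measure A {S \<in> space A. first_at d S}) ^ b +
    real F * (\<Sum>l\<in>{n..<2 * n}. \<beta> ^ l) +
    real F * (2 * (1 - (\<Sum>r=1..T. measure A {S \<in> space A. r \<in> Rel S}) / real F) ^ N2 +
      (\<Sum>l\<in>{1..<n}. \<beta> ^ l)) / real (k - (N + 2 * T * b))"
proof -
  let ?I = "{..<N2}" and ?I' = "{N2..<N}" and ?c = "k - (N + 2 * T * b)"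
  let ?p = "(\<Sum>r=1..T. measure A {S \<in> space A. r \<in> Rel S}) / real F"
  define u where "u = (\<Sum>h<2 * T. measure (drawn k) (unjammed k d N b h))"
  define UJ where "UJ = (\<Union>h<2 * T. unjammed k d N b h)"
  define C where "C = (\<lambda>\<alpha> t l. cluster_event k (act b \<alpha>) t l)"
  define V where "V = (\<lambda>\<alpha> t. quiet k (act b \<alpha>) ?I t)"
  define V' where "V' = (\<lambda>\<alpha> t. quiet k (act b \<alpha>) ?I' t)"
  interpret P: prob_space "drawn k" by (rule prob_space_drawn)
  have I: "?I \<subseteq> {..<N}" "?I' \<subseteq> {..<N}" "?I \<subseteq> {..<k}" "?I' \<subseteq> {..<k}" using N k by auto
  have Nk: "N \<le> k" "N + 2 * T * b \<le> k" using k by auto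
  have [measurable]: "UJ \<in> sets (drawn k)" unfolding UJ_def using unjammed(1)[OF Nk(2)] by auto
  have C_sets [measurable]: "C \<alpha> t l \<in> sets (drawn k)" for \<alpha> t l
    unfolding C_def by (rule cluster_event_sets[OF Nk(1)])
  have V_sets [measurable]: "V \<alpha> t \<in> sets (drawn k)" "V' \<alpha> t \<in> sets (drawn k)" for \<alpha> t
    unfolding V_def V'_def by (rule quiet_sets[OF I(3)] quiet_sets[OF I(4)])+
  have \<beta>0: "\<beta> \<ge> 0" unfolding \<beta> using load_nonneg by simp
  have bound: "q \<le> u + (\<Sum>t\<in>main. \<Sum>l\<in>{n..<2 * n}. measure (drawn k) (C \<alpha> t l)) +
      (\<Sum>t\<in>main. measure (drawn k) (V \<alpha> t) + measure (drawn k) (V' \<alpha> t) +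
         (\<Sum>l\<in>{1..<n}. measure (drawn k) (C \<alpha> t l))) / real ?c" if \<alpha>: "\<alpha> \<in> schedules" for \<alpha>
  proof -
    define LG where "LG = (\<Union>t\<in>main. \<Union>l\<in>{n..<2 * n}. C \<alpha> t l)"
    define B where "B = (\<lambda>t. V \<alpha> t \<union> V' \<alpha> t \<union> (\<Union>l\<in>{1..<n}. C \<alpha> t l))"
    define MK where "MK = all_succeed k (act b \<alpha>) F - UJ - LG"
    have [measurable]: "LG \<in> sets (drawn k)" "B t \<in> sets (drawn k)" "MK \<in> sets (drawn k)" for t
      unfolding LG_def B_def MK_def using C_sets V_sets all_succeed_sets \<open>UJ \<in> sets (drawn k)\<close> by auto
    have "measure (drawn k) MK \<le> (\<Sum>t\<in>main. measure (drawn k) (B t)) / real ?c"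
    proof (rule P.measure_card_ge_le)
      fix S assume "S \<in> MK"
      then have S: "S \<in> space (drawn k)" "all_succeed_within k (act b \<alpha>) S (real F)"
        and no: "S \<notin> UJ" "S \<notin> LG"
        by (auto simp: MK_def all_succeed_def)
      have jam: "\<not> successful k (act b \<alpha>) S i t" if "d < t" "t \<le> d + T" for i t
        using unjammed_or_jammed[OF Nk(2) S(1), of \<alpha>] no(1) that unfolding UJ_def by blast
      have "?c \<le> card {t \<in> main. \<exists>i. successful k (act b \<alpha>) S i t}"
        unfolding main_def by (rule successes_ge_tests[OF Nk(2) drawn_subset[OF S(1)] jam S(2)])
      also have "\<dots> \<le> card {t \<in> main. S \<in> B t}"
      proof (rule card_mono)
        show "{t \<in> main. \<exists>i. successful k (act b \<alpha>) S i t} \<subseteq> {t \<in> main. S \<in> B t}"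
        proof
          fix t assume "t \<in> {t \<in> main. \<exists>i. successful k (act b \<alpha>) S i t}"
          then obtain i where t: "t \<in> main" "successful k (act b \<alpha>) S i t" by auto
          have "?I \<union> ?I' \<subseteq> {..<N}" "?I \<inter> ?I' = {}" using I by auto
          from success_events[OF \<alpha> Nk(1) S(1) jam t(2,1) n(1) this]
          show "t \<in> {t \<in> main. S \<in> B t}"
            using no(2) t(1) by (simp add: LG_def B_def C_def V_def V'_def)
        qed
      qed simp
      finally show "?c \<le> card {t \<in> main. S \<in> B t}" .
    qed (use k in auto)
    also have "\<dots> \<le> (\<Sum>t\<in>main. measure (drawn k) (V \<alpha> t) + measure (drawn k) (V' \<alpha> t) +
         (\<Sum>l\<in>{1..<n}. measure (drawn k) (C \<alpha> t l))) / real ?c"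
    proof (intro divide_right_mono sum_mono)
      fix t
      have "measure (drawn k) (B t) \<le> measure (drawn k) (V \<alpha> t \<union> V' \<alpha> t) +
          measure (drawn k) (\<Union>l\<in>{1..<n}. C \<alpha> t l)"
        unfolding B_def using C_sets V_sets by (intro measure_Un_le) auto
      also have "\<dots> \<le> measure (drawn k) (V \<alpha> t) + measure (drawn k) (V' \<alpha> t) +
          (\<Sum>l\<in>{1..<n}. measure (drawn k) (C \<alpha> t l))"
        using C_sets V_sets
        by (intro add_mono measure_Un_le P.finite_measure_subadditive_finite) auto
      finally show "measure (drawn k) (B t) \<le> measure (drawn k) (V \<alpha> t) + measure (drawn k) (V' \<alpha> t) +
          (\<Sum>l\<in>{1..<n}. measure (drawn k) (C \<alpha> t l))" .
    qed simp
    finally have MK: "measure (drawn k) MK \<le> (\<Sum>t\<in>main. measure (drawn k) (V \<alpha> t) + measure (drawn k) (V' \<alpha> t) +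
         (\<Sum>l\<in>{1..<n}. measure (drawn k) (C \<alpha> t l))) / real ?c" .
    have LG: "measure (drawn k) LG \<le> (\<Sum>t\<in>main. \<Sum>l\<in>{n..<2 * n}. measure (drawn k) (C \<alpha> t l))"
    proof -
      have "measure (drawn k) LG \<le> (\<Sum>t\<in>main. measure (drawn k) (\<Union>l\<in>{n..<2 * n}. C \<alpha> t l))"
        unfolding LG_def using C_sets by (intro P.finite_measure_subadditive_finite) auto
      also have "\<dots> \<le> (\<Sum>t\<in>main. \<Sum>l\<in>{n..<2 * n}. measure (drawn k) (C \<alpha> t l))"
        using C_sets by (intro sum_mono P.finite_measure_subadditive_finite) auto
      finally show ?thesis .
    qed
    have UJ: "measure (drawn k) UJ \<le> u"
      unfolding UJ_def u_def using unjammed(1)[OF Nk(2)]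
      by (intro P.finite_measure_subadditive_finite) auto
    have "q \<le> measure (drawn k) (all_succeed k (act b \<alpha>) F)" by (rule q[OF \<alpha>])
    also have "\<dots> \<le> measure (drawn k) (UJ \<union> LG \<union> MK)"
    proof (rule P.finite_measure_mono)
      show "all_succeed k (act b \<alpha>) F \<subseteq> UJ \<union> LG \<union> MK" by (auto simp: MK_def)
    qed measurable
    also have "\<dots> \<le> measure (drawn k) (UJ \<union> LG) + measure (drawn k) MK"
      by (intro measure_Un_le) auto
    also have "measure (drawn k) (UJ \<union> LG) \<le> measure (drawn k) UJ + measure (drawn k) LG"
      by (intro measure_Un_le) auto
    finally show ?thesis using UJ LG MK by simp
  qed
  \<comment> \<open>The hypotheses on \<open>n\<close> leave a factor 2 of room because cluster
    sizes go up to just below \<open>2 * n\<close>.\<close>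
  have C_avg: "avg (\<lambda>\<alpha>. measure (drawn k) (C \<alpha> t l)) \<le> \<beta> ^ l" if "l < 2 * n" for t l
    unfolding C_def \<beta> using that n by (intro avg_cluster_event Nk(1)) auto
  have V_avg: "avg (\<lambda>\<alpha>. measure (drawn k) (V \<alpha> t)) = (1 - ?p) ^ N2"
      "avg (\<lambda>\<alpha>. measure (drawn k) (V' \<alpha> t)) = (1 - ?p) ^ N2" if "t \<in> main" for t
    unfolding V_def V'_def using avg_quiet[OF Nk(1) I(1) that, of b] avg_quiet[OF Nk(1) I(2) that, of b] N
    by simp_all
  have "d + F \<in> main" using TF by (simp add: main_def)
  then have p1: "?p \<le> 1" using pav_hits[of "d + F"] pav_le_1[of "hits (d + F)"] by simp
  have "q = avg (\<lambda>_. q)" by (simp add: avg_const)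
  also have "\<dots> \<le> avg (\<lambda>\<alpha>. u + (\<Sum>t\<in>main. \<Sum>l\<in>{n..<2 * n}. measure (drawn k) (C \<alpha> t l)) +
      (\<Sum>t\<in>main. measure (drawn k) (V \<alpha> t) + measure (drawn k) (V' \<alpha> t) +
         (\<Sum>l\<in>{1..<n}. measure (drawn k) (C \<alpha> t l))) / real ?c)"
    by (intro avg_mono bound)
  also have "\<dots> = u + (\<Sum>t\<in>main. \<Sum>l\<in>{n..<2 * n}. avg (\<lambda>\<alpha>. measure (drawn k) (C \<alpha> t l))) +
      (\<Sum>t\<in>main. avg (\<lambda>\<alpha>. measure (drawn k) (V \<alpha> t)) + avg (\<lambda>\<alpha>. measure (drawn k) (V' \<alpha> t)) +
         (\<Sum>l\<in>{1..<n}. avg (\<lambda>\<alpha>. measure (drawn k) (C \<alpha> t l)))) / real ?c"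
    by (simp add: avg_add avg_sum avg_const avg_divide)
  also have "\<dots> \<le> u + (\<Sum>t\<in>main. \<Sum>l\<in>{n..<2 * n}. \<beta> ^ l) +
      (\<Sum>t\<in>main. 2 * (1 - ?p) ^ N2 + (\<Sum>l\<in>{1..<n}. \<beta> ^ l)) / real ?c"
    using C_avg V_avg by (intro add_mono divide_right_mono sum_mono) auto
  also have "\<dots> = u + real (card main) * (\<Sum>l\<in>{n..<2 * n}. \<beta> ^ l) +
      real (card main) * (2 * (1 - ?p) ^ N2 + (\<Sum>l\<in>{1..<n}. \<beta> ^ l)) / real ?c" by simp
  also have "\<dots> \<le> u + real F * (\<Sum>l\<in>{n..<2 * n}. \<beta> ^ l) +
      real F * (2 * (1 - ?p) ^ N2 + (\<Sum>l\<in>{1..<n}. \<beta> ^ l)) / real ?c"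
    using card_main_le \<beta>0 p1
    by (intro add_mono divide_right_mono mult_right_mono sum_nonneg add_nonneg_nonneg) auto
  finally show ?thesis using sum_unjammed[OF Nk(2)] by (simp add: u_def)
qed

end

section \<open>Lower bounds on the frequency of attempts\<close>

context nonadaptive
begin

text \<open>When \<open>K\<close> stations are activated simultaneously, at most half of them can succeed in the first
  \<open>K / 2\<close> rounds, so a station must often transmit later.\<close>

lemma late_attempt:
  assumes q: "q \<le> measure (drawn K) {S \<in> space (drawn K). all_succeed_within K (\<lambda>_. 0) S L}"
    and K: "K \<ge> 1" and L: "L \<le> real G"
  shows "q / 2 \<le> measure A {S \<in> space A. \<exists>r\<in>S. K < 2 * r \<and> r \<le> G}"
proof -
  interpret P: prob_space "drawn K" by (rule prob_space_drawn)
  let ?E = "{S \<in> space (drawn K). all_succeed_within K (\<lambda>_. 0) S L}"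
  let ?G = "\<lambda>i. {S \<in> space (drawn K). \<forall>j\<in>{i}. \<exists>r\<in>S j. K < 2 * r \<and> r \<le> G}"
  let ?p = "measure A {S \<in> space A. \<exists>r\<in>S. K < 2 * r \<and> r \<le> G}"
  have meas: "Measurable.pred A (\<lambda>S. \<exists>r\<in>S. K < 2 * r \<and> r \<le> G)"
    unfolding Bex_def by measurable
  have "measure (drawn K) ?E \<le> (\<Sum>i<K. measure (drawn K) (?G i)) / real (K - K div 2)"
  proof (rule P.measure_card_ge_le)
    show "?E \<in> sets (drawn K)" by (rule all_succeed_within_measurable[OF nonadaptive])
    show "?G i \<in> sets (drawn K)" if "i \<in> {..<K}" for i
      using that meas by (intro pred_coord) auto
    show "0 < K - K div 2" using K by simp
    fix S assume S: "S \<in> ?E"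
    have "\<exists>t. successful K (\<lambda>_. 0) S i t \<and> real t \<le> L" if "i < K" for i
      using S that by (auto simp: all_succeed_within_def)
    then obtain \<tau> where \<tau>: "\<And>i. i < K \<Longrightarrow> successful K (\<lambda>_. 0) S i (\<tau> i) \<and> real (\<tau> i) \<le> L" by metis
    have mem: "\<tau> i \<in> S i \<and> \<tau> i \<ge> 1 \<and> \<tau> i \<le> G" if "i < K" for i
    proof -
      have "\<tau> i \<in> S i" using successfulD(3)[of K "\<lambda>_. 0" S i "\<tau> i"] \<tau>[OF that] by simp
      then show ?thesis using drawn_subset[of S K i] S that \<tau>[OF that] L by auto
    qed
    have "inj_on \<tau> {..<K}" using \<tau> by (intro inj_onI) (metis lessThan_iff successful_station_unique)
    then have "card {i \<in> {..<K}. 2 * \<tau> i \<le> K} \<le> card {1..K div 2}"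
      using mem by (intro card_inj_on_le[of \<tau>]) (auto intro: inj_on_subset)
    moreover have "card {..<K} = card {i \<in> {..<K}. 2 * \<tau> i \<le> K} + card {i \<in> {..<K}. K < 2 * \<tau> i}"
    proof (subst card_Un_disjoint[symmetric])
      show "card {..<K} = card ({i \<in> {..<K}. 2 * \<tau> i \<le> K} \<union> {i \<in> {..<K}. K < 2 * \<tau> i})"
        by (rule arg_cong[where f = card]) auto
    qed auto
    moreover have "card {i \<in> {..<K}. K < 2 * \<tau> i} \<le> card {i \<in> {..<K}. S \<in> ?G i}"
      using mem S by (intro card_mono) auto
    ultimately show "K - K div 2 \<le> card {i \<in> {..<K}. S \<in> ?G i}" by simp
  qed simp
  also have "(\<Sum>i<K. measure (drawn K) (?G i)) = real K * ?p"
  proof -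
    have "measure (drawn K) (?G i) = ?p" if "i < K" for i
      using that meas by (subst measure_coords) auto
    then show ?thesis by simp
  qed
  also have "real K * ?p / real (K - K div 2) \<le> 2 * ?p"
  proof -
    have "real K \<le> 2 * real (K - K div 2)" by linarith
    then have "real K * ?p \<le> (2 * real (K - K div 2)) * ?p" by (intro mult_right_mono) auto
    moreover have "0 < real (K - K div 2)" using K by simp
    ultimately show ?thesis by (subst pos_divide_le_eq) (simp_all only: mult_ac)
  qed
  finally show ?thesis using q by simp
qed

text \<open>A nonempty drawn set has a least element. If all events \<open>first_at d\<close> were
  null, so would be their countable union. This provides the local round \<open>d\<close> on which
  the jammers rely.\<close>

lemma first_attempt_exists:
  assumes "0 < measure A {S \<in> space A. \<exists>r\<in>S. K < 2 * r \<and> r \<le> G}"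
  shows "\<exists>d. 0 < measure A {S \<in> space A. first_at d S}"
proof (rule ccontr)
  assume "\<not> ?thesis"
  then have "measure A {S \<in> space A. first_at d S} = 0" for d
    by (metis measure_nonneg order_le_less)
  then have null: "emeasure A {S \<in> space A. first_at d S} = 0" for d
    by (simp add: emeasure_eq_measure)
  have "emeasure A (\<Union>d. {S \<in> space A. first_at d S}) = 0"
    by (rule emeasure_UN_eq_0[OF null]) auto
  then have "measure A (\<Union>d. {S \<in> space A. first_at d S}) = 0" by (simp add: measure_def)
  moreover have "measure A {S \<in> space A. \<exists>r\<in>S. K < 2 * r \<and> r \<le> G} \<le> measure A (\<Union>d. {S \<in> space A. first_at d S})"
  proof (rule finite_measure_mono)
    show "{S \<in> space A. \<exists>r\<in>S. K < 2 * r \<and> r \<le> G} \<subseteq> (\<Union>d. {S \<in> space A. first_at d S})"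
    proof
      fix S assume S: "S \<in> {S \<in> space A. \<exists>r\<in>S. K < 2 * r \<and> r \<le> G}"
      then obtain r where "r \<in> S" by blast
      then have "first_at (LEAST r. r \<in> S) S"
        unfolding first_at_def by (auto intro: LeastI dest: not_less_Least)
      then show "S \<in> (\<Union>d. {S \<in> space A. first_at d S})" using S by blast
    qed
  qed auto
  ultimately show False using assms by simp
qed

end

section \<open>Lacunary relevant attempts, one per scale\<close>

section \<open>Attempts on separated scales\<close>

text \<open>With \<open>K = (16 * l) ^ s\<close> this is the range in which
  \<open>late_attempt\<close> finds an attempt when its upper limit is \<open>l * K\<close>. The
  base \<open>16 * l\<close> leaves a factor 8 between consecutive ranges.\<close>

definition scale_rounds :: "nat \<Rightarrow> nat \<Rightarrow> nat set" where
  "scale_rounds l s = {r. (16 * l) ^ s < 2 * r \<and> r \<le> l * (16 * l) ^ s}"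

text \<open>Only the first attempt on a scale counts, so each scale contributes at most one relevant
  round.\<close>

definition scale_hit :: "nat \<Rightarrow> nat \<Rightarrow> nat set \<Rightarrow> nat \<Rightarrow> bool" where
  "scale_hit l s S r \<longleftrightarrow> r \<in> S \<and> r \<in> scale_rounds l s \<and> (\<forall>r'<r. r' \<in> scale_rounds l s \<longrightarrow> r' \<notin> S)"

definition scale_hits :: "nat \<Rightarrow> nat \<Rightarrow> nat set \<Rightarrow> nat set" where
  "scale_hits l m S = {r. \<exists>s\<in>{1..m}. scale_hit l s S r}"

text \<open>The next range starts beyond \<open>16 * l * (16 * l) ^ s / 2\<close>, which is 8 times
  the upper end of range \<open>s\<close>.\<close>

lemma scale_separated:
  assumes "s < s'" "x \<in> scale_rounds l s" "y \<in> scale_rounds l s'"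
  shows "8 * x \<le> y"
proof -
  have l: "l > 0" using assms(2) by (cases "l = 0") (auto simp: scale_rounds_def)
  have "16 * l * (16 * l) ^ s \<le> (16 * l) ^ s'"
    using power_increasing[of "Suc s" s' "16 * l"] assms(1) l by simp
  then show ?thesis using assms(2,3) by (simp add: scale_rounds_def)
qed

lemma scale_hit_unique: "scale_hit l s S r \<Longrightarrow> scale_hit l s S r' \<Longrightarrow> r = r'"
  unfolding scale_hit_def by (metis linorder_neqE_nat)

lemma scale_hits_separated:
  assumes "x \<in> scale_hits l m S" "y \<in> scale_hits l m S" "x < y"
  shows "8 * x \<le> y"
proof -
  obtain s s' where s: "scale_hit l s S x" "scale_hit l s' S y"
    using assms(1,2) by (auto simp: scale_hits_def)
  consider "s < s'" | "s = s'" | "s' < s" by linarith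
  then show ?thesis
  proof cases
    case 1
    then show ?thesis using s scale_separated[of s s' x l y] by (auto simp: scale_hit_def)
  next
    case 2
    then show ?thesis using s scale_hit_unique assms(3) by blast
  next
    case 3
    then have "8 * y \<le> x" using s scale_separated[of s' s y l x] by (auto simp: scale_hit_def)
    then show ?thesis using assms(3) by simp
  qed
qed

text \<open>For \<open>x < y\<close>, separation gives both \<open>7 * y \<le> e\<close> and
  \<open>8 * x + 7 * e \<le> y\<close>, impossible for positive \<open>e\<close>.\<close>

lemma scale_hits_sidon:
  assumes "r \<in> scale_hits l m S" "r + e \<in> scale_hits l m S"
    and "q \<in> scale_hits l m S" "q + e \<in> scale_hits l m S" "e > 0"
  shows "r = q"
proof -
  have "False" if "x < y" and x: "x \<in> scale_hits l m S" "x + e \<in> scale_hits l m S"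
      and y: "y \<in> scale_hits l m S" "y + e \<in> scale_hits l m S" for x y
  proof -
    have "8 * (x + e) \<le> y + e" using scale_hits_separated[OF x(2) y(2)] that(1) by simp
    moreover have "8 * y \<le> y + e" using scale_hits_separated[OF y] assms(5) by simp
    ultimately show False using assms(5) by simp
  qed
  then show ?thesis using assms by (metis linorder_neqE_nat)
qed

lemma card_scale_hits: "card (scale_hits l m S) \<le> m"
proof -
  have "scale_hits l m S = (\<Union>s\<in>{1..m}. {r. scale_hit l s S r})" by (auto simp: scale_hits_def)
  also have "card \<dots> \<le> (\<Sum>s\<in>{1..m}. card {r. scale_hit l s S r})" by (rule card_UN_le) simp
  also have "\<dots> \<le> (\<Sum>s\<in>{1..m}. 1)"
  proof (rule sum_mono)
    fix s
    have "\<forall>x\<in>{r. scale_hit l s S r}. \<forall>y\<in>{r. scale_hit l s S r}. x = y"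
      using scale_hit_unique by blast
    then show "card {r. scale_hit l s S r} \<le> 1"
      by (cases "finite {r. scale_hit l s S r}")
        (simp_all add: card_le_Suc0_iff_eq del: mem_Collect_eq)
  qed
  finally show ?thesis by simp
qed

lemma scale_subset: "s \<in> {1..m} \<Longrightarrow> l > 0 \<Longrightarrow> scale_rounds l s \<subseteq> {1..l * (16 * l) ^ m}"
proof
  fix r assume s: "s \<in> {1..m}" "l > 0" and r: "r \<in> scale_rounds l s"
  have "(16 * l) ^ s \<le> (16 * l) ^ m" using s by (intro power_increasing) auto
  then have "l * (16 * l) ^ s \<le> l * (16 * l) ^ m" by (rule mult_left_mono) simp
  moreover have "0 < 2 * r" "r \<le> l * (16 * l) ^ s" using r unfolding scale_rounds_def by auto
  ultimately show "r \<in> {1..l * (16 * l) ^ m}" by (simp only: atLeastAtMost_iff) linarith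
qed

context nonadaptive
begin

lemma scale_hit_meas [measurable]: "Measurable.pred A (\<lambda>S. scale_hit l s S r)"
  unfolding scale_hit_def by measurable

lemma scale_hits_meas: "Measurable.pred A (\<lambda>S. r \<in> scale_hits l m S)"
  unfolding scale_hits_def mem_Collect_eq by (intro pred_intros_finite scale_hit_meas) simp

text \<open>An attempt on a scale entails a first one there, and the scales are disjoint, so their
  contributions add up.\<close>

lemma scale_hits_mass:
  assumes l: "l > 0"
    and late: "\<And>s. s \<in> {1..m} \<Longrightarrow> c \<le> measure A {S \<in> space A. \<exists>r\<in>S. r \<in> scale_rounds l s}"
  shows "real m * c \<le> (\<Sum>r=1..l * (16 * l) ^ m. measure A {S \<in> space A. r \<in> scale_hits l m S})"
proof -
  have fin: "finite (scale_rounds l s)" for s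
    by (rule finite_subset[of _ "{..l * (16 * l) ^ s}"]) (auto simp: scale_rounds_def)
  have "c \<le> (\<Sum>r\<in>scale_rounds l s. measure A {S \<in> space A. r \<in> scale_hits l m S})" if s: "s \<in> {1..m}" for s
  proof -
    have "{S \<in> space A. \<exists>r\<in>S. r \<in> scale_rounds l s} \<subseteq> (\<Union>r\<in>scale_rounds l s. {S \<in> space A. r \<in> scale_hits l m S})"
    proof
      fix S assume S: "S \<in> {S \<in> space A. \<exists>r\<in>S. r \<in> scale_rounds l s}"
      define r where "r = (LEAST r. r \<in> S \<and> r \<in> scale_rounds l s)"
      have "\<exists>r. r \<in> S \<and> r \<in> scale_rounds l s" using S by blast
      then have "r \<in> S \<and> r \<in> scale_rounds l s" unfolding r_def by (rule LeastI_ex)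
      then have hit: "scale_hit l s S r" "r \<in> scale_rounds l s"
        unfolding scale_hit_def r_def by (auto dest: not_less_Least)
      then have "S \<in> {S \<in> space A. r \<in> scale_hits l m S}"
        using S s unfolding scale_hits_def by blast
      then show "S \<in> (\<Union>r\<in>scale_rounds l s. {S \<in> space A. r \<in> scale_hits l m S})"
        using hit(2) by blast
    qed
    then have "measure A {S \<in> space A. \<exists>r\<in>S. r \<in> scale_rounds l s} \<le>
        measure A (\<Union>r\<in>scale_rounds l s. {S \<in> space A. r \<in> scale_hits l m S})"
      using fin scale_hits_meas by (intro finite_measure_mono) auto
    also have "\<dots> \<le> (\<Sum>r\<in>scale_rounds l s. measure A {S \<in> space A. r \<in> scale_hits l m S})"
      using fin scale_hits_meas by (intro finite_measure_subadditive_finite) auto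
    finally show ?thesis using late[OF s] by simp
  qed
  then have "(\<Sum>s\<in>{1..m}. c) \<le> (\<Sum>s\<in>{1..m}. \<Sum>r\<in>scale_rounds l s. measure A {S \<in> space A. r \<in> scale_hits l m S})"
    by (intro sum_mono)
  also have "\<dots> = (\<Sum>r\<in>(\<Union>s\<in>{1..m}. scale_rounds l s). measure A {S \<in> space A. r \<in> scale_hits l m S})"
  proof (rule sum.UNION_disjoint[symmetric])
    show "\<forall>s\<in>{1..m}. \<forall>s'\<in>{1..m}. s \<noteq> s' \<longrightarrow> scale_rounds l s \<inter> scale_rounds l s' = {}"
    proof (intro ballI impI equals0I)
      fix s s' r assume "s \<noteq> s'" "r \<in> scale_rounds l s \<inter> scale_rounds l s'"
      then have "8 * r \<le> r" "r > 0"
        using scale_separated[of s s' r l r] scale_separated[of s' s r l r] by (auto simp: neq_iff scale_rounds_def)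
      then show False by simp
    qed
  qed (use fin in auto)
  also have "\<dots> \<le> (\<Sum>r=1..l * (16 * l) ^ m. measure A {S \<in> space A. r \<in> scale_hits l m S})"
    using scale_subset[OF _ l, of _ m] by (intro sum_mono2 UN_least) simp_all
  finally show ?thesis by simp
qed

lemma sidon_stream_scale_hits:
  assumes "l > 0" "F > 0"
    and late: "\<And>s. s \<in> {1..m} \<Longrightarrow> 1 / 4 \<le> measure A {S \<in> space A. \<exists>r\<in>S. r \<in> scale_rounds l s}"
  shows "sidon_stream A (scale_hits l m) F (l * (16 * l) ^ m) m"
proof
  show "scale_hits l m S \<subseteq> S \<inter> {1..l * (16 * l) ^ m}" for S
    using scale_subset[OF _ assms(1)] by (fastforce simp: scale_hits_def scale_hit_def)
  show "real m / 4 \<le> (\<Sum>r=1..l * (16 * l) ^ m. measure A {S \<in> space A. r \<in> scale_hits l m S})"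
    using scale_hits_mass[OF assms(1) late] by simp
qed (use assms scale_hits_meas card_scale_hits scale_hits_sidon in auto)

lemma stream_all:
  assumes "F > 0"
  shows "stream A (\<lambda>S. S \<inter> {1..T}) F T"
proof
  show "Measurable.pred A (\<lambda>S. r \<in> S \<inter> {1..T})" for r by measurable
qed (use assms in auto)

end

section \<open>Choice of parameters and numerical estimates\<close>

section \<open>Asymptotics\<close>

lemma sum_powers_le:
  fixes \<beta> :: real
  assumes "0 \<le> \<beta>" "\<beta> \<le> 1 / 2"
  shows "(\<Sum>l\<in>{n..<m}. \<beta> ^ l) \<le> 2 * \<beta> ^ n"
proof (induction "m - n" arbitrary: n)
  case 0
  then show ?case using assms by simp
next
  case (Suc d)
  then have "{n..<m} = insert n {Suc n..<m}" by auto
  then have "(\<Sum>l\<in>{n..<m}. \<beta> ^ l) = \<beta> ^ n + (\<Sum>l\<in>{Suc n..<m}. \<beta> ^ l)" by simp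
  also have "\<dots> \<le> \<beta> ^ n + 2 * \<beta> ^ Suc n"
  proof (intro add_left_mono Suc.hyps(1))
    show "d = m - Suc n" using Suc.hyps(2) by simp
  qed
  also have "2 * \<beta> ^ Suc n \<le> \<beta> ^ n"
    using mult_right_mono[OF assms(2), of "\<beta> ^ n"] assms(1) by simp
  finally show ?case by simp
qed

lemma one_minus_power_le_exp:
  fixes p :: real
  assumes "p \<le> 1"
  shows "(1 - p) ^ n \<le> exp (- (p * real n))"
proof -
  have "(1 - p) ^ n \<le> exp (- p) ^ n"
    using assms exp_ge_add_one_self[of "- p"] by (intro power_mono) auto
  then show ?thesis by (simp add: exp_of_nat_mult[symmetric] mult.commute)
qed

text \<open>The contradiction for a single \<open>k\<close>; for fixed \<open>K0\<close> and
  \<open>\<delta> > 0\<close> the conditions \<open>large\<close> hold for all large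
  \<open>L\<close>. The constant is \<open>1 / (516 * 1024)\<close>: avoidance then costs each
  cluster member a factor of at most \<open>L\<close> to the power -516. The exponent 4 pays for the
  choices, and the remaining 512 turns \<open>L / (256 * ln L)\<close> members into
  \<open>exp (- (2 * L))\<close>.\<close>

lemma (in nonadaptive) no_fast_instance:
  fixes k d K0 :: nat and \<phi> c :: real
  defines "L \<equiv> ln (real k)" and "c \<equiv> 1 / 528384"
    and "\<delta> \<equiv> measure A {S \<in> space A. first_at d S}"
  assumes late: "\<And>K G. K0 \<le> K \<Longrightarrow> real K * ln (real K) \<le> real G \<Longrightarrow>
        1 / 4 \<le> measure A {S \<in> space A. \<exists>r\<in>S. K < 2 * r \<and> r \<le> G}"
    and fast: "\<And>a. 1 / 2 \<le> measure (drawn k) {S \<in> space (drawn k). all_succeed_within k a S \<phi>}"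
    and \<phi>: "\<phi> \<le> c * real k * L / (ln L)\<^sup>2"
    and large: "real K0 \<le> 16 * L" "32 \<le> L" "16 \<le> L / (8 * ln L)" "1 \<le> c * exp L * L / (ln L)\<^sup>2"
      "16 * L ^ 3 * exp (L / 2) \<le> exp L / 8" "2 * L * exp (L / 2) < c * exp L * L / (ln L)\<^sup>2"
      "4 * L * exp (L / 2) * exp (- (\<delta> * L\<^sup>2)) \<le> 1 / 16" "2 * L * exp (- L) \<le> 1 / 16"
      "4 * L \<le> exp L / 4" "1 \<le> ln L"
  shows False
proof -
  define l where "l = nat \<lceil>L\<rceil>"
  \<comment> \<open>As many scales as fit below the square root of \<open>k\<close>:
    \<open>(16 * l) ^ m \<le> exp (L / 2)\<close>.\<close>
  define m where "m = nat \<lfloor>L / (2 * ln (16 * real l))\<rfloor>"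
  define T where "T = l * (16 * l) ^ m"
  \<comment> \<open>The square is needed because \<open>\<delta>\<close> may be tiny:
    \<open>exp (- (\<delta> * L\<^sup>2))\<close> eventually beats the number of blocks, which is of
    order \<open>L * exp (L / 2)\<close>.\<close>
  define b where "b = l\<^sup>2"
  define N2 where "N2 = k div 4"
  define N where "N = 2 * N2"
  define X where "X = c * real k * L / (ln L)\<^sup>2"
  define F where "F = nat \<lceil>X\<rceil>"
  \<comment> \<open>With a sixteenth of \<open>m\<close>, cluster sizes below \<open>2 * n\<close>
    stay below \<open>m / 8\<close>.\<close>
  define n where "n = m div 16"
  have kpos: "real k > 0"
    using large(2) by (cases "k = 0") (auto simp: L_def)
  then have expL: "exp L = real k" by (simp add: L_def)
  have kexp2: "real k * exp (- (2 * L)) = exp (- L)"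
    unfolding expL[symmetric] by (simp add: exp_add[symmetric])
  have l: "L \<le> real l" "real l \<le> 2 * L" "l > 0"
    using large(2) unfolding l_def by linarith+
  have lnL: "0 < ln L" using large(10) by simp
  have ln16: "ln (16 * real l) \<le> 2 * ln L" "0 < ln (16 * real l)"
  proof -
    have "32 * L \<le> L * L" using large(2) by (intro mult_right_mono) auto
    then have "16 * real l \<le> L * L" using l(2) by linarith
    then have "ln (16 * real l) \<le> ln (L * L)" using l large(2) by (subst ln_le_cancel_iff) auto
    then show "ln (16 * real l) \<le> 2 * ln L" using large(2) by (simp add: ln_mult)
    show "0 < ln (16 * real l)" using l large(2) by (intro ln_gt_zero) auto
  qed
  have m_le: "real m * (2 * ln (16 * real l)) \<le> L"
  proof -
    have "real m \<le> L / (2 * ln (16 * real l))"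
      unfolding m_def using ln16 large(2) by (subst of_nat_nat) auto
    then show ?thesis using ln16 by (simp add: field_simps)
  qed
  \<comment> \<open>The unrounded value is at least twice the claimed bound, so the loss of at most
    1 by the floor is harmless.\<close>
  have m_ge: "L / (8 * ln L) \<le> real m"
  proof -
    have "L / (4 * ln L) \<le> L / (2 * ln (16 * real l))"
      using ln16 lnL large(2) by (intro divide_left_mono) auto
    moreover have "L / (2 * ln (16 * real l)) - 1 \<le> real m"
      unfolding m_def by linarith
    moreover have "L / (4 * ln L) = 2 * (L / (8 * ln L))" using lnL by simp
    ultimately show ?thesis using large(3) by linarith
  qed
  have m_L: "real m \<le> L"
  proof -
    have "1 \<le> 2 * ln (16 * real l)"
    proof -
      have "ln L \<le> ln (16 * real l)" using l large(2) by (subst ln_le_cancel_iff) auto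
      then show ?thesis using large(10) by simp
    qed
    then have "real m * 1 \<le> real m * (2 * ln (16 * real l))" by (intro mult_left_mono) auto
    then show ?thesis using m_le by simp
  qed
  have pow: "real ((16 * l) ^ s) \<le> exp (L / 2)" if "s \<le> m" for s
  proof -
    have "real ((16 * l) ^ s) = exp (real s * ln (16 * real l))"
      using l by (simp add: exp_of_nat_mult)
    also have "\<dots> \<le> exp (real m * ln (16 * real l))" using that ln16 by simp
    also have "\<dots> \<le> exp (L / 2)" using m_le by simp
    finally show ?thesis .
  qed
  have T: "real T \<le> 2 * L * exp (L / 2)"
    unfolding T_def of_nat_mult using l pow[of m] large(2) by (intro mult_mono) auto
  have b: "L\<^sup>2 \<le> real b" "real b \<le> 4 * L\<^sup>2"
  proof -
    show "L\<^sup>2 \<le> real b" unfolding b_def of_nat_power using l large(2) by (intro power_mono) auto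
    have "(real l)\<^sup>2 \<le> (2 * L)\<^sup>2" using l by (intro power_mono) auto
    then show "real b \<le> 4 * L\<^sup>2" by (simp add: b_def power_mult_distrib)
  qed
  have X: "1 \<le> X" "real T < X" using large(4,6) T unfolding X_def expL by auto
  have F: "X \<le> real F" "real F \<le> 2 * X" "F > 0" "T < F" "real F \<le> real k * L"
  proof -
    show 1: "X \<le> real F" "real F \<le> 2 * X" unfolding F_def using X(1) by linarith+
    then show "F > 0" "T < F" using X by linarith+
    have "2 * X = real k * L * (2 * c / (ln L)\<^sup>2)" by (simp add: X_def)
    also have "\<dots> \<le> real k * L * 1"
    proof (rule mult_left_mono)
      have "1 \<le> (ln L)\<^sup>2" using large(10) by simp
      then show "2 * c / (ln L)\<^sup>2 \<le> 1" by (simp add: c_def divide_le_eq)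
    qed (use kpos large(2) in auto)
    finally show "real F \<le> real k * L" using 1 by simp
  qed
  have Tb: "2 * real T * real b \<le> real k / 8"
  proof -
    have "2 * real T * real b \<le> 2 * (2 * L * exp (L / 2)) * (4 * L\<^sup>2)"
      using T b large(2) by (intro mult_mono) auto
    also have "\<dots> = 16 * L ^ 3 * exp (L / 2)" by (simp add: power2_eq_square power3_eq_cube)
    finally show ?thesis using large(5) expL by simp
  qed
  have k16: "4 * L \<le> real k / 4" using large(9) expL by simp
  have N2: "real k / 8 \<le> real N2" "4 * real N2 \<le> real k"
    using k16 large(2) unfolding N2_def by linarith+
  have N: "real k / 4 \<le> real N" "2 * real N \<le> real k" using N2 by (auto simp: N_def)
  have tests: "real k / 4 \<le> real k - (real N + 2 * real T * real b)" using N Tb kpos by linarith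
  have kN: "N + 2 * T * b < k"
  proof -
    have "real (N + 2 * T * b) < real k" using tests kpos by simp
    then show ?thesis by (simp only: of_nat_less_iff)
  qed
  have tests': "real k / 4 \<le> real (k - (N + 2 * T * b))" using tests kN by (simp add: of_nat_diff)
  have \<delta>: "0 \<le> \<delta>" "\<delta> \<le> 1" unfolding \<delta>_def by auto
  have jam: "2 * real T * (1 - \<delta>) ^ b \<le> 1 / 16"
  proof -
    have "2 * real T * (1 - \<delta>) ^ b \<le> 2 * (2 * L * exp (L / 2)) * exp (- (\<delta> * L\<^sup>2))"
    proof (intro mult_mono)
      have "(1 - \<delta>) ^ b \<le> exp (- (\<delta> * real b))" using \<delta> by (intro one_minus_power_le_exp)
      also have "\<dots> \<le> exp (- (\<delta> * L\<^sup>2))" using \<delta> b by (simp add: mult_left_mono)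
      finally show "(1 - \<delta>) ^ b \<le> exp (- (\<delta> * L\<^sup>2))" .
    qed (use T \<delta> large(2) in auto)
    then show ?thesis using large(7) by simp
  qed
  have fastF: "1 / 2 \<le> measure (drawn k) (all_succeed k a F)" for a
  proof -
    interpret P: prob_space "drawn k" by (rule prob_space_drawn)
    have "\<phi> \<le> real F" using \<phi> F(1) by (simp add: X_def)
    then have "{S \<in> space (drawn k). all_succeed_within k a S \<phi>} \<subseteq> all_succeed k a F"
      unfolding all_succeed_def all_succeed_within_def by (blast intro: order_trans)
    then have "measure (drawn k) {S \<in> space (drawn k). all_succeed_within k a S \<phi>} \<le> measure (drawn k) (all_succeed k a F)"
      by (intro P.finite_measure_mono all_succeed_sets)
    then show ?thesis using fast[of a] by simp
  qed
  define load where "load = (\<Sum>r=1..T. measure A {S \<in> space A. r \<in> S})"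
  have load0: "load \<ge> 0" unfolding load_def by (intro sum_nonneg) auto
  show False
  \<comment> \<open>\<open>load * N2 / F\<close> is the mean number of attempts, up to local round
    \<open>T\<close>, of half the stream in a round of \<open>main\<close>. If it is at least
    \<open>2 * L\<close>, a round is quiet for that half with probability at most
    \<open>exp (- (2 * L))\<close>. Otherwise the same quantity bounds the choices in the cluster
    count.\<close>
  proof (cases "2 * L * real F \<le> load * real N2")
    case True
    interpret D: stream A "\<lambda>S. S \<inter> {1..T}" d F T N by (rule stream_all[OF F(3)])
    have eq: "(\<Sum>r=1..T. measure A {S \<in> space A. r \<in> S \<inter> {1..T}}) = load"
      unfolding load_def by (intro sum.cong) auto
    have "d + F \<in> D.main" using F(4) by (simp add: D.main_def)
    then have p1: "load / real F \<le> 1" using D.pav_hits[of "d + F"] D.pav_le_1[of "D.hits (d + F)"] eq by simp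
    have "1 / 2 \<le> 2 * real T * (1 - \<delta>) ^ b + 2 * real F * (1 - load / real F) ^ N2"
      using D.success_prob_le_dense[OF N_def kN F(4) fastF] unfolding eq \<delta>_def .
    also have "2 * real F * (1 - load / real F) ^ N2 \<le> 2 * (real k * L) * exp (- (2 * L))"
    proof (intro mult_mono)
      have "2 * L \<le> load / real F * real N2" using True F(3) by (simp add: field_simps)
      then have "exp (- (load / real F * real N2)) \<le> exp (- (2 * L))" by simp
      then show "(1 - load / real F) ^ N2 \<le> exp (- (2 * L))"
        using one_minus_power_le_exp[OF p1, of N2] by (rule order_trans[rotated])
    qed (use F p1 kpos large(2) in auto)
    also have "2 * (real k * L) * exp (- (2 * L)) = 2 * L * exp (- L)"
      using kexp2 by (simp add: mult_ac)
    finally show False using jam large(8) by simp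
  next
    case False
    \<comment> \<open>Use \<open>late\<close> with \<open>K = (16 * l) ^ s\<close> and
      \<open>G = l * K\<close>. Here \<open>s \<ge> 1\<close> ensures \<open>K0 \<le> K\<close>, and
      \<open>K \<le> exp L\<close> gives \<open>ln K \<le> L \<le> l\<close>.\<close>
    have late': "1 / 4 \<le> measure A {S \<in> space A. \<exists>r\<in>S. r \<in> scale_rounds l s}" if s: "s \<in> {1..m}" for s
    proof -
      define K where "K = (16 * l) ^ s"
      have "16 * l \<le> K" unfolding K_def using s l power_increasing[of 1 s "16 * l"] by simp
      moreover have "real K0 \<le> real (16 * l)" using large(1) l by simp
      ultimately have "K0 \<le> K" by linarith
      have "K > 0" using l by (simp add: K_def)
      have "exp (L / 2) \<le> exp L" using large(2) by simp
      moreover have "real K \<le> exp (L / 2)" unfolding K_def by (rule pow) (use s in simp)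
      ultimately have "real K \<le> exp L" by linarith
      then have "ln (real K) \<le> L" using \<open>K > 0\<close> ln_mono[of "real K" "exp L"] by simp
      then have "real K * ln (real K) \<le> real K * real l" using l by (intro mult_left_mono) auto
      then have "real K * ln (real K) \<le> real (l * K)" by (simp add: mult.commute)
      from late[OF \<open>K0 \<le> K\<close> this] show ?thesis
        by (simp add: scale_rounds_def K_def)
    qed
    interpret B: sidon_stream A "scale_hits l m" d F T N m
      unfolding T_def by (rule sidon_stream_scale_hits[OF l(3) F(3) late'])
    define E where "E = exp (- (real N * real m / (16 * real F)))"
    define \<beta> where "\<beta> = real N * real m * (real m * B.load / real F) * E"
    have Bload: "B.load = load" by (simp add: B.load_def load_def)
    have n: "n > 0" "16 * n \<le> m" "4 * n \<le> N" "L / (256 * ln L) \<le> real n"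
    proof -
      have m16: "16 \<le> m" using m_ge large(3) by linarith
      show "n > 0" "16 * n \<le> m" using m16 by (auto simp: n_def)
      have "real (4 * n) \<le> 4 * L" using m_L unfolding n_def by linarith
      then have "real (4 * n) \<le> real N" using k16 N by linarith
      then show "4 * n \<le> N" by (simp only: of_nat_le_iff)
      have "m \<le> 32 * (m div 16)" using m16 by presburger
      then have "real m \<le> 32 * real n" unfolding n_def by linarith
      then have "L / (8 * ln L) \<le> 32 * real n" using m_ge by linarith
      then show "L / (256 * ln L) \<le> real n" using lnL by (simp add: field_simps)
    qed
    \<comment> \<open>The origin of the constant: \<open>528384 = 516 * 32 * 32\<close>. One 32
      comes from \<open>16 * F\<close> with \<open>F \<le> 2 * X\<close>, the other from
      \<open>N \<ge> k / 4\<close> and \<open>m \<ge> L / (8 * ln L)\<close>.\<close>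
    have E: "E \<le> exp (- (516 * ln L))"
    proof -
      have "516 * ln L * (16 * real F) \<le> real N * real m"
      proof -
        have "516 * ln L * (16 * real F) \<le> 516 * ln L * (16 * (2 * X))"
          using F(2) lnL by (intro mult_left_mono) auto
        also have "\<dots> = (real k / 4) * (L / (8 * ln L))"
          using lnL by (simp add: X_def c_def power2_eq_square field_simps)
        also have "\<dots> \<le> real N * real m" using N m_ge lnL large(2) by (intro mult_mono) auto
        finally show ?thesis .
      qed
      then have "516 * ln L \<le> real N * real m / (16 * real F)" using F(3) by (simp add: pos_le_divide_eq)
      then show ?thesis by (simp add: E_def)
    qed
    have Lpow: "exp (- (real j * ln L)) = inverse (L ^ j)" for j
    proof -
      have "exp (real j * ln L) = L ^ j" using large(2) by (simp add: exp_of_nat_mult)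
      then show ?thesis by (simp add: exp_minus)
    qed
    have E0: "0 \<le> E" "E \<le> 1" by (simp_all add: E_def)
    have \<beta>0: "0 \<le> \<beta>" unfolding \<beta>_def Bload using load0 E0 by simp
    \<comment> \<open>In this case \<open>load * N2 / F\<close> is below \<open>2 * L\<close>; with
      \<open>m \<le> L\<close> the choices for one member amount to at most
      \<open>L ^ 4\<close>.\<close>
    have \<beta>: "\<beta> \<le> exp (- (512 * ln L))"
    proof -
      have "\<beta> = (load * real N2 / real F) * (2 * (real m * real m)) * E"
        by (simp add: \<beta>_def Bload N_def)
      also have "\<dots> \<le> (2 * L) * (2 * (L * L)) * exp (- (516 * ln L))"
      proof (intro mult_mono)
        show "load * real N2 / real F \<le> 2 * L" using False F(3) by (simp add: field_simps)
      qed (use m_L E E0 load0 large(2) in auto)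
      also have "\<dots> \<le> L ^ 4 * exp (- (516 * ln L))"
      proof (rule mult_right_mono)
        have "4 * L ^ 3 \<le> L * L ^ 3" using large(2) by (intro mult_right_mono) auto
        then show "2 * L * (2 * (L * L)) \<le> L ^ 4" by (simp add: power3_eq_cube power4_eq_xxxx)
      qed simp
      also have "L ^ 4 = exp (4 * ln L)"
        using large(2) exp_of_nat_mult[of 4 "ln L"] by simp
      also have "exp (4 * ln L) * exp (- (516 * ln L)) = exp (- (512 * ln L))"
        by (simp add: exp_add[symmetric])
      finally show ?thesis .
    qed
    \<comment> \<open>This crude bound suffices for the Markov term:
      \<open>F / (k / 4) \<le> 4 * L\<close> times \<open>4 / (1024 * L)\<close> is at most
      1/64.\<close>
    have small: "exp (- (512 * ln L)) \<le> 1 / (1024 * L)"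
    proof -
      have "exp (- (512 * ln L)) \<le> exp (- (real 4 * ln L))" using lnL by simp
      also have "\<dots> = inverse (L ^ 4)" by (rule Lpow)
      also have "\<dots> \<le> inverse (1024 * L)"
      proof (rule le_imp_inverse_le)
        have "(32::real) ^ 3 * L \<le> L ^ 3 * L" using large(2) by (intro mult_right_mono power_mono) auto
        then show "1024 * L \<le> L ^ 4" using large(2) by (simp add: power4_eq_xxxx power3_eq_cube)
      qed (use large(2) in simp)
      finally show ?thesis unfolding inverse_eq_divide .
    qed
    have half: "1 / (1024 * L) \<le> 1 / 2" using large(2) by (simp add: field_simps)
    have EB: "E \<le> 1 / (1024 * L)" "\<beta> \<le> 1 / (1024 * L)"
    proof -
      have "exp (- (516 * ln L)) \<le> exp (- (512 * ln L))" using lnL by simp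
      then show "E \<le> 1 / (1024 * L)" using E small by linarith
      show "\<beta> \<le> 1 / (1024 * L)" using \<beta> small by linarith
    qed
    have \<beta>2: "\<beta> \<le> 1 / 2" using EB half by linarith
    have \<beta>n: "\<beta> ^ n \<le> exp (- (2 * L))"
    proof -
      have "\<beta> ^ n \<le> exp (- (512 * ln L)) ^ n" using \<beta> \<beta>0 by (intro power_mono)
      also have "\<dots> = exp (- (real n * (512 * ln L)))" by (simp add: exp_of_nat_mult[symmetric])
      also have "\<dots> \<le> exp (- (2 * L))"
      proof -
        have "2 * L = L / (256 * ln L) * (512 * ln L)" using lnL by simp
        also have "\<dots> \<le> real n * (512 * ln L)" using n(4) lnL by (intro mult_right_mono) auto
        finally show ?thesis by simp
      qed
      finally show ?thesis .
    qed
    let ?p = "(\<Sum>r=1..T. measure A {S \<in> space A. r \<in> scale_hits l m S}) / real F"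
    have "d + F \<in> B.main" using F(4) by (simp add: B.main_def)
    then have p1: "?p \<le> 1" using B.pav_hits[of "d + F"] B.pav_le_1[of "B.hits (d + F)"] by simp
    have pE: "(1 - ?p) ^ N2 \<le> E"
    proof -
      have "real N * real m / (16 * real F) \<le> real m / 4 / real F * real N2"
        using F(3) by (simp add: N_def field_simps)
      also have "\<dots> \<le> ?p * real N2" using B.Rel_mass by (intro mult_right_mono divide_right_mono) auto
      finally have "exp (- (?p * real N2)) \<le> E" by (simp add: E_def)
      then show ?thesis using one_minus_power_le_exp[OF p1, of N2] by simp
    qed
    have "1 / 2 \<le> 2 * real T * (1 - \<delta>) ^ b + real F * (\<Sum>l\<in>{n..<2 * n}. \<beta> ^ l) +
        real F * (2 * (1 - ?p) ^ N2 + (\<Sum>l\<in>{1..<n}. \<beta> ^ l)) / real (k - (N + 2 * T * b))"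
      using B.success_prob_le_sparse[OF N_def kN F(4) n(1-3) \<beta>_def[unfolded E_def] fastF] unfolding \<delta>_def .
    also have "real F * (\<Sum>l\<in>{n..<2 * n}. \<beta> ^ l) \<le> (real k * L) * (2 * exp (- (2 * L)))"
    proof (intro mult_mono)
      show "(\<Sum>l\<in>{n..<2 * n}. \<beta> ^ l) \<le> 2 * exp (- (2 * L))"
        using sum_powers_le[OF \<beta>0 \<beta>2, of n "2 * n"] \<beta>n by linarith
    qed (use F \<beta>0 kpos large(2) in \<open>auto intro: sum_nonneg\<close>)
    also have "(real k * L) * (2 * exp (- (2 * L))) = 2 * L * exp (- L)"
      using kexp2 by (simp add: mult_ac)
    also have "real F * (2 * (1 - ?p) ^ N2 + (\<Sum>l\<in>{1..<n}. \<beta> ^ l)) / real (k - (N + 2 * T * b))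
        \<le> (real k * L) * (4 * (1 / (1024 * L))) / (real k / 4)"
    proof (rule frac_le)
      show "real F * (2 * (1 - ?p) ^ N2 + (\<Sum>l\<in>{1..<n}. \<beta> ^ l)) \<le> (real k * L) * (4 * (1 / (1024 * L)))"
      proof (intro mult_mono)
        have "(\<Sum>l\<in>{1..<n}. \<beta> ^ l) \<le> 2 * (1 / (1024 * L))"
          using sum_powers_le[OF \<beta>0 \<beta>2, of 1 n] EB(2) unfolding power_one_right by linarith
        then show "2 * (1 - ?p) ^ N2 + (\<Sum>l\<in>{1..<n}. \<beta> ^ l) \<le> 4 * (1 / (1024 * L))"
          using pE EB(1) by linarith
        show "0 \<le> 2 * (1 - ?p) ^ N2 + (\<Sum>l\<in>{1..<n}. \<beta> ^ l)"
          using p1 \<beta>0 by (intro add_nonneg_nonneg mult_nonneg_nonneg zero_le_power sum_nonneg) auto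
      qed (use F kpos large(2) in auto)
      show "real k / 4 \<le> real (k - (N + 2 * T * b))" by (rule tests')
    qed (use kpos large(2) in auto)
    also have "(real k * L) * (4 * (1 / (1024 * L))) / (real k / 4) = 1 / 64"
      using kpos large(2) by (simp add: field_simps)
    finally show False using jam large(8) by simp
  qed
qed

theorem theorem4p1:
  fixes \<eta> :: real
  assumes "\<eta> > 0"
  shows "\<not> (\<exists>(A :: nat set measure) (f :: nat \<Rightarrow> real).
           nonadaptive_algorithm A \<and>
           f \<in> o(\<lambda>k. real k * (ln (real k) / (ln (ln (real k)))\<^sup>2)) \<and>
           achieves_latency_whp A \<eta> f)"
proof
  assume "\<exists>(A :: nat set measure) (f :: nat \<Rightarrow> real).
           nonadaptive_algorithm A \<and>
           f \<in> o(\<lambda>k. real k * (ln (real k) / (ln (ln (real k)))\<^sup>2)) \<and>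
           achieves_latency_whp A \<eta> f"
  then obtain A and f :: "nat \<Rightarrow> real" where A: "nonadaptive_algorithm A"
    and f: "f \<in> o(\<lambda>k. real k * (ln (real k) / (ln (ln (real k)))\<^sup>2))"
    and ach: "achieves_latency_whp A \<eta> f" by blast
  interpret nonadaptive A by standard (rule A)
  define c :: real where "c = 1 / 528384"
  have f_ev: "eventually (\<lambda>k. f k \<le> c * real k * ln (real k) / (ln (ln (real k)))\<^sup>2) sequentially"
  proof -
    have "eventually (\<lambda>k. norm (f k) \<le> c * norm (real k * (ln (real k) / (ln (ln (real k)))\<^sup>2))) sequentially"
      using f by (rule landau_o.smallD) (simp add: c_def)
    moreover have "eventually (\<lambda>k::nat. 0 \<le> real k * (ln (real k) / (ln (ln (real k)))\<^sup>2)) sequentially"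
      by real_asymp
    ultimately show ?thesis
    proof eventually_elim
      case (elim k)
      have "f k \<le> norm (f k)" by simp
      also note elim(1)
      also have "c * norm (real k * (ln (real k) / (ln (ln (real k)))\<^sup>2)) =
          c * real k * ln (real k) / (ln (ln (real k)))\<^sup>2"
        using elim(2) by (simp only: real_norm_def abs_of_nonneg) simp
      finally show ?case .
    qed
  qed
  \<comment> \<open>From here on only success probability 1/2 is used, which
    \<open>\<eta> > 0\<close> guarantees for large \<open>k\<close>.\<close>
  have half_ev: "eventually (\<lambda>k::nat. 1 / 2 \<le> 1 - 1 / real k powr \<eta>) sequentially"
    using assms by real_asymp
  \<comment> \<open>A cruder latency bound, needed for all contention sizes from \<open>K0\<close>
    on, as the source of late attempts on every scale.\<close>
  have "eventually (\<lambda>k::nat. c * real k * ln (real k) / (ln (ln (real k)))\<^sup>2 \<le> real k * ln (real k)) sequentially"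
    unfolding c_def by real_asymp
  with f_ev half_ev eventually_ge_at_top[of 1]
  have "eventually (\<lambda>k. f k \<le> real k * ln (real k) \<and> 1 / 2 \<le> 1 - 1 / real k powr \<eta> \<and> 1 \<le> k) sequentially"
    by eventually_elim auto
  then obtain K0 where K0: "\<And>K. K0 \<le> K \<Longrightarrow>
      f K \<le> real K * ln (real K) \<and> 1 / 2 \<le> 1 - 1 / real K powr \<eta> \<and> 1 \<le> K"
    by (auto simp: eventually_sequentially)
  have fast: "1 / 2 \<le> measure (drawn K) {S \<in> space (drawn K). all_succeed_within K a S (f K)}"
    if "K0 \<le> K" for K a
    using ach K0[OF that] unfolding achieves_latency_whp_def by (meson order_trans)
  have late: "1 / 4 \<le> measure A {S \<in> space A. \<exists>r\<in>S. K < 2 * r \<and> r \<le> G}"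
    if "K0 \<le> K" "real K * ln (real K) \<le> real G" for K G
    using late_attempt[OF fast[OF that(1)], of G] K0[OF that(1)] that(2) by auto
  obtain G :: nat where "real K0 * ln (real K0) \<le> real G" using real_arch_simple by blast
  \<comment> \<open>The choice of \<open>d\<close> involves only the algorithm and
    \<open>K0\<close>, so \<open>\<delta>\<close> is a positive constant before \<open>k\<close> is
    chosen.\<close>
  then have "0 < measure A {S \<in> space A. \<exists>r\<in>S. K0 < 2 * r \<and> r \<le> G}" using late[of K0 G] by simp
  then obtain d where d: "0 < measure A {S \<in> space A. first_at d S}" using first_attempt_exists by blast
  define \<delta> where "\<delta> = measure A {S \<in> space A. first_at d S}"
  have \<delta>: "\<delta> > 0" using d by (simp add: \<delta>_def)
  \<comment> \<open>With \<open>x = ln k\<close>, so that \<open>k\<close> becomes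
    \<open>exp x\<close>, the side conditions are inequalities in one real variable.\<close>
  have ln_top: "filterlim (\<lambda>k::nat. ln (real k)) at_top sequentially" by real_asymp
  have "eventually (\<lambda>x::real. real K0 \<le> 16 * x) at_top" by real_asymp
  moreover have "eventually (\<lambda>x::real. 32 \<le> x) at_top" by real_asymp
  moreover have "eventually (\<lambda>x::real. 16 \<le> x / (8 * ln x)) at_top" by real_asymp
  moreover have "eventually (\<lambda>x::real. 1 \<le> c * exp x * x / (ln x)\<^sup>2) at_top" unfolding c_def by real_asymp
  moreover have "eventually (\<lambda>x::real. 16 * x ^ 3 * exp (x / 2) \<le> exp x / 8) at_top" by real_asymp
  moreover have "eventually (\<lambda>x::real. 2 * x * exp (x / 2) < c * exp x * x / (ln x)\<^sup>2) at_top"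
    unfolding c_def by real_asymp
  moreover have "eventually (\<lambda>x::real. 4 * x * exp (x / 2) * exp (- (\<delta> * x\<^sup>2)) \<le> 1 / 16) at_top"
    using \<delta> by real_asymp
  moreover have "eventually (\<lambda>x::real. 2 * x * exp (- x) \<le> 1 / 16) at_top" by real_asymp
  moreover have "eventually (\<lambda>x::real. 4 * x \<le> exp x / 4) at_top" by real_asymp
  moreover have "eventually (\<lambda>x::real. 1 \<le> ln x) at_top" by real_asymp
  ultimately have "eventually (\<lambda>x::real. real K0 \<le> 16 * x \<and> 32 \<le> x \<and> 16 \<le> x / (8 * ln x) \<and>
      1 \<le> c * exp x * x / (ln x)\<^sup>2 \<and> 16 * x ^ 3 * exp (x / 2) \<le> exp x / 8 \<and>
      2 * x * exp (x / 2) < c * exp x * x / (ln x)\<^sup>2 \<and>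
      4 * x * exp (x / 2) * exp (- (\<delta> * x\<^sup>2)) \<le> 1 / 16 \<and> 2 * x * exp (- x) \<le> 1 / 16 \<and>
      4 * x \<le> exp x / 4 \<and> 1 \<le> ln x) at_top"
    by eventually_elim (intro conjI)
  from eventually_conj[OF eventually_conj[OF eventually_compose_filterlim[OF this ln_top] f_ev] eventually_ge_at_top[of K0]]
  obtain k where k: "f k \<le> c * real k * ln (real k) / (ln (ln (real k)))\<^sup>2" "K0 \<le> k"
    and large: "real K0 \<le> 16 * ln (real k)" "32 \<le> ln (real k)" "16 \<le> ln (real k) / (8 * ln (ln (real k)))"
      "1 \<le> c * exp (ln (real k)) * ln (real k) / (ln (ln (real k)))\<^sup>2"
      "16 * ln (real k) ^ 3 * exp (ln (real k) / 2) \<le> exp (ln (real k)) / 8"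
      "2 * ln (real k) * exp (ln (real k) / 2) < c * exp (ln (real k)) * ln (real k) / (ln (ln (real k)))\<^sup>2"
      "4 * ln (real k) * exp (ln (real k) / 2) * exp (- (\<delta> * (ln (real k))\<^sup>2)) \<le> 1 / 16"
      "2 * ln (real k) * exp (- ln (real k)) \<le> 1 / 16"
      "4 * ln (real k) \<le> exp (ln (real k)) / 4" "1 \<le> ln (ln (real k))"
    by (auto simp: eventually_sequentially)
  show False
    by (rule no_fast_instance[OF late fast[OF k(2)] k(1)[unfolded c_def] large(1-3) large(4)[unfolded c_def]
      large(5) large(6)[unfolded c_def] large(7)[unfolded \<delta>_def] large(8-10)])
qed

end
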